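(* Let $N\ge2$ and $s\in(0,1)$. There is a number $\gamma^+\in(\tilde\gamma,+\infty)$ such that for any $p>1+\frac{2s}{\gamma^+}$ the equation $$\mathcal I_N^-u(x)+u^p(x)=0\quad\text{in }\mathbb{R}^N_+$$ admits a nonnegative (viscosity) supersolution $u\in C(\mathbb{R}^N)\cap L^\infty(\mathbb{R}^N)$ satisfying $$u(x)=0\ \ \forall x\in\mathbb{R}^N\setminus\mathbb{R}^N_+,\qquad u(x)>0\ \ \forall x\in\mathbb{R}^N_+,\qquad \lim_{|x|\to+\infty}u(x)=0.$$
   Context: $\mathbb{R}^N_+=\{x=(x',x_N)\in\mathbb{R}^{N-1}\times\mathbb{R}: x_N>0\}$. For a unit vector $\xi\in\mathbb{R}^N$, $$\mathcal I_\xi u(x)=C_s\int_0^{+\infty}\frac{u(x+\tau\xi)+u(x-\tau\xi)-2u(x)}{\tau^{1+2s}}\,d\tau,$$ where $C_s>0$ is a normalizing constant depending only on $s$ (chosen so that $\mathcal I_\xi u(x)\to\langle D^2u(x)\xi,\xi\rangle$ as $s\to1^-$). $\mathcal V_N$ is the set of orthonormal bases $\{\xi_1,\dots,\xi_N\}$ of $\mathbb{R}^N$, and $\mathcal I_N^-u(x)=\inf_{\{\xi_i\}\in\mathcal V_N}\sum_{i=1}^N\mathcal I_{\xi_i}u(x)$. The number $\tilde\gamma=\tilde\gamma(N,s)>0$ is the exponent for which $|x|^{-\tilde\gamma}$ is a fundamental solution of $\mathcal I_N^-$; explicitly, it is the unique positive zero of the function $$c(\gamma)=\int_0^{+\infty}\frac{\left(1+\tau^2+\frac{2}{\sqrt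 N}\tau\right)^{-\gamma/2}+\left(1+\tau^2-\frac{2}{\sqrt N}\tau\right)^{-\gamma/2}-2}{\tau^{1+2s}}\,d\tau,\qquad \gamma>0,$$ which is negative on $(0,\tilde\gamma)$ and positive on $(\tilde\gamma,+\infty)$. $\mathcal S$ is the space of functions $u:\mathbb{R}^N\to\mathbb{R}$ such that (i) for every $x\in\mathbb{R}^N_+$ and unit vector $\xi$, the map $\tau\in\mathbb{R}\mapsto u(x+\tau\xi)$ is measurable; (ii) there are $\alpha\in[0,2s)$ and $C>0$ with $|u(x)|\le C(1+|x|)^\alpha$ for all $x\in\mathbb{R}^N$. $LSC(\mathbb{R}^N_+)$ means lower semicontinuous on $\mathbb{R}^N_+$. Viscosity supersolution: $u\in\mathcal S\cap LSC(\mathbb{R}^N_+)$ is a viscosity supersolution of $\mathcal I u+u^p=0$ in $\mathbb{R}^N_+$ if for every $x_0\in\mathbb{R}^N_+$, $r>0$ with $B_r(x_0)\subseteq\mathbb{R}^N_+$ and $\varphi\in C^2(\overline{B_r(x_0)})$ with $\varphi(x_0)=u(x_0)$ and $\varphi\le u$ in $B_r(x_0)$, the function $\psi$ equal to $\varphi$ in $B_r(x_0)$ and to $u$ in $\mathbb{R}^N\setminus B_r(x_0)$ satisfies $\mathcal I\psi(x_0)+u(x_0)^p\le 0$. *)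

theory Defs
  imports "HOL-Analysis.Analysis"
begin

text \<open>
  \<open>\<real>\<^sup>N\<close> is written as \<open>\<real>\<^sup>N\<^sup>-\<^sup>1 \<times> \<real>\<close>, i.e. as the Euclidean space \<^typ>\<open>(real ^ 'm) \<times> real\<close> of dimension
  \<open>N = CARD('m) + 1\<close>.  As \<open>'m\<close> ranges over the (nonempty) finite types, \<open>N\<close> ranges
  over all integers \<open>\<ge> 2\<close>.
\<close>

definition half_space :: "((real ^ 'm) \<times> real) set"
  where "half_space = {x. snd x > 0}"

text \<open>The normalizing constant is the value \<open>C s\<close> of a function \<open>C\<close> of \<open>s\<close> alone.\<close>

definition dir_op :: "(real \<Rightarrow> real) \<Rightarrow> real \<Rightarrow> 'a::euclidean_space \<Rightarrow> ('a \<Rightarrow> real) \<Rightarrow> 'a \<Rightarrow> real"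
  where "dir_op C s \<xi> u x =
    C s * (LINT \<tau>:{0<..}|lebesgue.
      (u (x + \<tau> *\<^sub>R \<xi>) + u (x - \<tau> *\<^sub>R \<xi>) - 2 * u x) / \<tau> powr (1 + 2 * s))"

text \<open>
  \<open>C s\<close> is not pinned down further than being positive and making the operator in direction \<open>\<xi>\<close>
  converge to \<open>\<langle>D\<^sup>2u(x)\<xi>, \<xi>\<rangle>\<close> as \<open>s \<rightarrow> 1\<^sup>-\<close> (for bounded \<open>C\<^sup>2\<close> functions).  Since the operator only
  sees the restriction \<open>v(\<tau>) = u(x + \<tau>\<xi>)\<close> of \<open>u\<close> to a line, and \<open>\<langle>D\<^sup>2u(x)\<xi>, \<xi>\<rangle> = v''(0)\<close>,
  this is a condition on the real line with direction \<open>\<xi> = 1\<close>, independent of the dimension.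
\<close>

definition normalizing :: "(real \<Rightarrow> real) \<Rightarrow> bool"
  where "normalizing C \<longleftrightarrow>
    (\<forall>s. 0 < s \<and> s < 1 \<longrightarrow> C s > 0) \<and>
    (\<forall>v v' v'' :: real \<Rightarrow> real.
       bounded (range v) \<and>
       (\<forall>t. (v has_real_derivative v' t) (at t)) \<and>
       (\<forall>t. (v' has_real_derivative v'' t) (at t)) \<and>
       continuous_on UNIV v'' \<longrightarrow>
       (\<forall>t. ((\<lambda>s. dir_op C s 1 v t) \<longlongrightarrow> v'' t) (at_left 1)))"

definition orthonormal_bases :: "'a::euclidean_space set set"
  where "orthonormal_bases =
    {B. pairwise orthogonal B \<and> (\<forall>\<xi>\<in>B. norm \<xi> = 1) \<and> span B = UNIV}"

text \<open>
  On the functions to which the operator is applied below (\<open>C\<^sup>2\<close> up to the boundary in a ball around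
  \<open>x\<close>, with growth of order less than \<open>2s\<close> at infinity) the integrals converge absolutely and the
  sums are bounded uniformly over all orthonormal bases, so that the real infimum is the true one.
\<close>

definition op_minus :: "(real \<Rightarrow> real) \<Rightarrow> real \<Rightarrow> ('a::euclidean_space \<Rightarrow> real) \<Rightarrow> 'a \<Rightarrow> real"
  where "op_minus C s u x = (INF B\<in>orthonormal_bases. \<Sum>\<xi>\<in>B. dir_op C s \<xi> u x)"

definition c_fun :: "nat \<Rightarrow> real \<Rightarrow> real \<Rightarrow> real"
  where "c_fun N s \<gamma> =
    (LINT \<tau>:{0<..}|lebesgue.
      ((1 + \<tau>\<^sup>2 + 2 / sqrt (real N) * \<tau>) powr (- \<gamma> / 2) +
       (1 + \<tau>\<^sup>2 - 2 / sqrt (real N) * \<tau>) powr (- \<gamma> / 2) - 2) / \<tau> powr (1 + 2 * s))"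

definition gamma_tilde :: "nat \<Rightarrow> real \<Rightarrow> real"
  where "gamma_tilde N s = (THE \<gamma>. \<gamma> > 0 \<and> c_fun N s \<gamma> = 0)"

definition class_S :: "real \<Rightarrow> ((real ^ 'm) \<times> real \<Rightarrow> real) set"
  where "class_S s =
    {u. (\<forall>x\<in>half_space. \<forall>\<xi>. norm \<xi> = 1 \<longrightarrow>
           (\<lambda>\<tau>::real. u (x + \<tau> *\<^sub>R \<xi>)) \<in> borel_measurable lebesgue) \<and>
        (\<exists>\<alpha> C. 0 \<le> \<alpha> \<and> \<alpha> < 2 * s \<and> C > 0 \<and> (\<forall>x. \<bar>u x\<bar> \<le> C * (1 + norm x) powr \<alpha>))}"

definition lsc_on :: "'a::topological_space set \<Rightarrow> ('a \<Rightarrow> real) \<Rightarrow> bool"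
  where "lsc_on A u \<longleftrightarrow> (\<forall>x\<in>A. \<forall>a<u x. \<forall>\<^sub>F y in at x within A. a < u y)"

text \<open>
  \<open>\<phi> \<in> C\<^sup>2(K)\<close> for a closed ball \<open>K\<close>, with gradient \<open>g\<close> and Hessian \<open>H\<close>; derivatives are taken
  within \<open>K\<close>, so that they are one-sided on the boundary of \<open>K\<close>.
\<close>

definition C2_on :: "'a::euclidean_space set \<Rightarrow> ('a \<Rightarrow> real) \<Rightarrow> bool"
  where "C2_on K \<phi> \<longleftrightarrow>
    (\<exists>(g :: 'a \<Rightarrow> 'a) (H :: 'a \<Rightarrow> 'a \<Rightarrow>\<^sub>L 'a).
       (\<forall>x\<in>K. (\<phi> has_derivative (\<lambda>h. g x \<bullet> h)) (at x within K)) \<and>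
       (\<forall>x\<in>K. (g has_derivative blinfun_apply (H x)) (at x within K)) \<and>
       continuous_on K H)"

text \<open>Viscosity supersolutions of \<open>\<I>u + u\<^sup>p = 0\<close> in the half-space, for an operator \<open>\<I>\<close> of order \<open>2s\<close>.\<close>

definition viscosity_supersolution ::
  "real \<Rightarrow> (((real ^ 'm) \<times> real \<Rightarrow> real) \<Rightarrow> (real ^ 'm) \<times> real \<Rightarrow> real) \<Rightarrow> real \<Rightarrow>
   ((real ^ 'm) \<times> real \<Rightarrow> real) \<Rightarrow> bool"
  where "viscosity_supersolution s \<I> p u \<longleftrightarrow>
    u \<in> class_S s \<and> lsc_on half_space u \<and>
    (\<forall>x0\<in>half_space. \<forall>r>0. \<forall>\<phi>.
       ball x0 r \<subseteq> half_space \<and> C2_on (cball x0 r) \<phi> \<and>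
       \<phi> x0 = u x0 \<and> (\<forall>x\<in>ball x0 r. \<phi> x \<le> u x) \<longrightarrow>
       \<I> (\<lambda>x. if x \<in> ball x0 r then \<phi> x else u x) x0 + u x0 powr p \<le> 0)"

end

theory Submission
  imports Defs
begin

text \<open>
  Put \<open>y = x + e\<^sub>N\<close>. In the half-space take \<open>u\<close> to be a small multiple of
  \<open>min (|y|\<^sup>-\<^sup>\<gamma>) (x\<^sub>N\<^sup>a)\<close> with \<open>a = s/2\<close>, and \<open>u = 0\<close> outside. A minimum lies below each of its branches, so
  at every point it suffices to exhibit one orthonormal basis along whose lines the active branch is good.

  Where \<open>u\<close> is given by \<open>|y|\<^sup>-\<^sup>\<gamma>\<close>, choose the basis making equal angles with \<open>y\<close>. The full power
  contributes \<open>N c(\<gamma>) |y|\<^sup>-\<^sup>\<gamma>\<^sup>-\<^sup>2\<^sup>s\<close>, and the vanishing of \<open>u\<close> below the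
  half-space improves this by a fixed negative multiple of \<open>|y|\<^sup>-\<^sup>\<gamma>\<^sup>-\<^sup>2\<^sup>s\<close>, since one of the basis vectors has
  vertical component at least \<open>1/\<surd>N\<close> in modulus. As \<open>c\<close> is continuous and vanishes at the critical
  exponent, the total stays negative for some slightly larger \<open>\<gamma>\<close>.

  Where \<open>u\<close> is given by \<open>x\<^sub>N\<^sup>a\<close>, one has \<open>x\<^sub>N \<le> 1\<close>; in the standard basis only the vertical
  direction matters, and there the kernel integral is a negative multiple of \<open>x\<^sub>N\<^sup>a\<^sup>-\<^sup>2\<^sup>s\<close>.
\<close>

section \<open>Integrals against the singular kernel\<close>

text \<open>\<open>f\<close> stands for a second difference along a line. The weight is kept out of
  \<open>f\<close>, so that \<open>dir_op\<close> is \<open>C s\<close> times a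
  \<open>kernel_integral\<close> and inequalities between second differences pass directly to the
  operator.\<close>

definition kernel_integrable :: "real \<Rightarrow> (real \<Rightarrow> real) \<Rightarrow> bool"
  where "kernel_integrable s f \<longleftrightarrow> set_integrable lebesgue {0<..} (\<lambda>\<tau>. f \<tau> / \<tau> powr (1 + 2 * s))"

definition kernel_integral :: "real \<Rightarrow> (real \<Rightarrow> real) \<Rightarrow> real"
  where "kernel_integral s f = (LINT \<tau>:{0<..}|lebesgue. f \<tau> / \<tau> powr (1 + 2 * s))"

lemma kernel_integrable_add:
  "kernel_integrable s f \<Longrightarrow> kernel_integrable s g \<Longrightarrow> kernel_integrable s (\<lambda>\<tau>. f \<tau> + g \<tau>)"
  unfolding kernel_integrable_def by (simp add: add_divide_distrib set_integral_add(1))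

lemma kernel_integrable_diff:
  "kernel_integrable s f \<Longrightarrow> kernel_integrable s g \<Longrightarrow> kernel_integrable s (\<lambda>\<tau>. f \<tau> - g \<tau>)"
  unfolding kernel_integrable_def by (simp add: diff_divide_distrib set_integral_diff(1))

lemma kernel_integrable_cmult:
  "kernel_integrable s f \<Longrightarrow> kernel_integrable s (\<lambda>\<tau>. c * f \<tau>)"
  unfolding kernel_integrable_def using set_integrable_mult_right[of c lebesgue "{0<..}"]
  by (metis (no_types, lifting) set_integrable_cong times_divide_eq_right)

lemma kernel_integral_add:
  "kernel_integrable s f \<Longrightarrow> kernel_integrable s g \<Longrightarrow>
    kernel_integral s (\<lambda>\<tau>. f \<tau> + g \<tau>) = kernel_integral s f + kernel_integral s g"
  unfolding kernel_integrable_def kernel_integral_def by (simp add: add_divide_distrib)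

lemma kernel_integral_diff:
  "kernel_integrable s f \<Longrightarrow> kernel_integrable s g \<Longrightarrow>
    kernel_integral s (\<lambda>\<tau>. f \<tau> - g \<tau>) = kernel_integral s f - kernel_integral s g"
  unfolding kernel_integrable_def kernel_integral_def by (simp add: diff_divide_distrib)

lemma kernel_integral_cmult: "kernel_integral s (\<lambda>\<tau>. c * f \<tau>) = c * kernel_integral s f"
  unfolding kernel_integral_def by (simp flip: times_divide_eq_right)

lemma kernel_integral_lincomb:
  assumes "kernel_integrable s f" "kernel_integrable s g"
  shows "kernel_integral s (\<lambda>\<tau>. c * f \<tau> + d * g \<tau>) = c * kernel_integral s f + d * kernel_integral s g"
  using assms by (simp only: kernel_integral_add kernel_integrable_cmult kernel_integral_cmult)

lemma kernel_zero [simp]: "kernel_integrable s (\<lambda>\<tau>. 0)" "kernel_integral s (\<lambda>\<tau>. 0) = 0"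
  unfolding kernel_integral_def kernel_integrable_def set_integrable_def by simp_all

lemma kernel_integral_mono:
  assumes "kernel_integrable s f" "kernel_integrable s g" "\<And>\<tau>. 0 < \<tau> \<Longrightarrow> f \<tau> \<le> g \<tau>"
  shows "kernel_integral s f \<le> kernel_integral s g"
  using assms unfolding kernel_integrable_def kernel_integral_def
  by (intro set_integral_mono) (auto intro!: divide_right_mono)

lemma kernel_integrable_bound:
  assumes "kernel_integrable s g" "f \<in> borel_measurable borel" "\<And>\<tau>. 0 < \<tau> \<Longrightarrow> \<bar>f \<tau>\<bar> \<le> g \<tau>"
  shows "kernel_integrable s f"
proof -
  have "(\<lambda>\<tau>. f \<tau> / \<tau> powr (1 + 2 * s)) \<in> borel_measurable borel"
    using assms(2) by measurable
  then have "set_borel_measurable borel {0<..} (\<lambda>\<tau>. f \<tau> / \<tau> powr (1 + 2 * s))"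
    unfolding set_borel_measurable_def by measurable
  then have "set_borel_measurable lebesgue {0<..} (\<lambda>\<tau>. f \<tau> / \<tau> powr (1 + 2 * s))"
    unfolding set_borel_measurable_def by (auto intro!: measurable_completion)
  then show ?thesis
    using assms(1,3) unfolding kernel_integrable_def
    by (rule_tac set_integrable_bound[OF assms(1)[unfolded kernel_integrable_def]])
       (auto intro!: divide_right_mono order_trans[OF assms(3)])
qed

section \<open>Model integrals, domination and scaling\<close>

lemma absolutely_integrable_powr_at_top:
  fixes a e :: real
  assumes "e < -1" "0 < a"
  shows "set_integrable lebesgue {a..} (\<lambda>x. x powr e)"
    and "(LINT x:{a..}|lebesgue. x powr e) = - (a powr (e + 1)) / (e + 1)"
proof -
  note h = has_integral_powr_to_inf[OF assms]
  show 1: "set_integrable lebesgue {a..} (\<lambda>x. x powr e)"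
    using h by (intro nonnegative_absolutely_integrable_1) (auto simp: integrable_on_def)
  show "(LINT x:{a..}|lebesgue. x powr e) = - (a powr (e + 1)) / (e + 1)"
    using h set_lebesgue_integral_eq_integral(2)[OF 1] by (simp add: integral_unique)
qed

text \<open>All exact evaluations below reduce to this one: \<open>b = 0\<close> for constants,
  \<open>b = - \<gamma>\<close> for the mass lost below the half-space, \<open>b = a\<close> for the
  boundary profile. The condition \<open>b < 2 * s\<close> is integrability at infinity.\<close>

lemma kernel_tail:
  assumes "0 < s" "0 < r" "b < 2 * s"
  shows "kernel_integrable s (\<lambda>\<tau>. if \<tau> < r then 0 else \<tau> powr b)"
    and "kernel_integral s (\<lambda>\<tau>. if \<tau> < r then 0 else \<tau> powr b) = r powr (b - 2 * s) / (2 * s - b)"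
proof -
  have eq: "indicat_real {0<..} \<tau> *\<^sub>R ((if \<tau> < r then 0 else \<tau> powr b) / \<tau> powr (1 + 2 * s)) =
      indicat_real {r..} \<tau> *\<^sub>R \<tau> powr (b - 1 - 2 * s)" for \<tau>
    using assms by (auto simp: indicator_def powr_diff[symmetric] algebra_simps)
  show "kernel_integrable s (\<lambda>\<tau>. if \<tau> < r then 0 else \<tau> powr b)"
    using absolutely_integrable_powr_at_top(1)[of "b - 1 - 2 * s" r] assms
    unfolding kernel_integrable_def set_integrable_def eq by simp
  have "kernel_integral s (\<lambda>\<tau>. if \<tau> < r then 0 else \<tau> powr b) = - (r powr (b - 2 * s)) / (b - 2 * s)"
    using absolutely_integrable_powr_at_top(2)[of "b - 1 - 2 * s" r] assms
    unfolding kernel_integral_def set_lebesgue_integral_def eq by simp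
  also have "\<dots> = r powr (b - 2 * s) / (2 * s - b)"
    by (metis minus_diff_eq minus_divide_divide)
  finally show "kernel_integral s (\<lambda>\<tau>. if \<tau> < r then 0 else \<tau> powr b) = r powr (b - 2 * s) / (2 * s - b)" .
qed

text \<open>The quotient is \<open>\<tau> powr (1 - 2 * s)\<close>, integrable at \<open>0\<close>
  because \<open>s < 1\<close>. Hence second differences of order \<open>\<tau>\<^sup>2\<close> are
  harmless near \<open>0\<close>.\<close>

lemma kernel_integrable_near:
  assumes "s < 1" "0 < r"
  shows "kernel_integrable s (\<lambda>\<tau>. if \<tau> < r then \<tau>\<^sup>2 else 0)"
proof -
  have "(\<lambda>x. x powr (1 - 2 * s)) integrable_on {0..r}"
    using assms by (intro integrable_on_powr_from_0) auto
  then have i: "set_integrable lebesgue {0..r} (\<lambda>x. x powr (1 - 2 * s))"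
    by (intro nonnegative_absolutely_integrable_1) auto
  then have i: "set_integrable lebesgue {0<..<r} (\<lambda>x. x powr (1 - 2 * s))"
    by (rule set_integrable_subset) auto
  have eq: "indicat_real {0<..} \<tau> *\<^sub>R ((if \<tau> < r then \<tau>\<^sup>2 else 0) / \<tau> powr (1 + 2 * s)) =
      indicat_real {0<..<r} \<tau> *\<^sub>R \<tau> powr (1 - 2 * s)" for \<tau>
  proof (cases "0 < \<tau>")
    case True
    then have "\<tau>\<^sup>2 = \<tau> powr 2" by simp
    then show ?thesis using True by (auto simp: indicator_def powr_diff[symmetric] simp del: powr_numeral)
  qed (auto simp: indicator_def)
  show ?thesis using i unfolding kernel_integrable_def set_integrable_def eq .
qed

text \<open>\<open>D\<close> is obtained before \<open>f\<close> is given and depends only on the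
  constants. One lower bound thus serves all directions at once, which later makes the infimum over
  orthonormal bases a genuine one.\<close>

lemma kernel_integrable_dominated:
  assumes "0 < s" "s < 1" "0 < r" "b < 2 * s"
  obtains D where "\<And>f. f \<in> borel_measurable borel \<Longrightarrow>
      (\<And>\<tau>. 0 < \<tau> \<Longrightarrow> \<tau> < r \<Longrightarrow> \<bar>f \<tau>\<bar> \<le> K * \<tau>\<^sup>2) \<Longrightarrow> (\<And>\<tau>. r \<le> \<tau> \<Longrightarrow> \<bar>f \<tau>\<bar> \<le> M * \<tau> powr b) \<Longrightarrow>
      kernel_integrable s f \<and> - D \<le> kernel_integral s f"
proof -
  define H where "H = (\<lambda>\<tau>. K * (if \<tau> < r then \<tau>\<^sup>2 else 0) + M * (if \<tau> < r then 0 else \<tau> powr b))"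
  have H: "kernel_integrable s H"
    unfolding H_def using assms
    by (intro kernel_integrable_add kernel_integrable_cmult kernel_integrable_near kernel_tail)
  show ?thesis
  proof (rule that[of "kernel_integral s H"])
    fix f :: "real \<Rightarrow> real"
    assume f: "f \<in> borel_measurable borel" "\<And>\<tau>. 0 < \<tau> \<Longrightarrow> \<tau> < r \<Longrightarrow> \<bar>f \<tau>\<bar> \<le> K * \<tau>\<^sup>2"
      "\<And>\<tau>. r \<le> \<tau> \<Longrightarrow> \<bar>f \<tau>\<bar> \<le> M * \<tau> powr b"
    have le: "\<bar>f \<tau>\<bar> \<le> H \<tau>" if "0 < \<tau>" for \<tau>
      using f(2,3)[of \<tau>] that by (auto simp: H_def)
    then have i: "kernel_integrable s f"
      using kernel_integrable_bound[OF H f(1)] by blast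
    have "kernel_integral s (\<lambda>\<tau>. - 1 * H \<tau>) \<le> kernel_integral s f"
      using H i le by (intro kernel_integral_mono kernel_integrable_cmult) (auto dest!: le simp: abs_le_iff)
    then show "kernel_integrable s f \<and> - kernel_integral s H \<le> kernel_integral s f"
      using i by (simp only: kernel_integral_cmult) simp
  qed
qed

text \<open>The substitution \<open>\<tau> = R * t\<close>; the factor
  \<open>R powr (- 2 * s)\<close> expresses that the operator has order
  \<open>2 * s\<close>.\<close>

lemma kernel_scale:
  assumes "0 < R"
  shows "kernel_integrable s f \<Longrightarrow> kernel_integrable s (\<lambda>\<tau>. f (\<tau> / R))"
    and "kernel_integral s (\<lambda>\<tau>. f (\<tau> / R)) = R powr (- 2 * s) * kernel_integral s f"
proof -
  define F where "F = (\<lambda>\<tau>. indicat_real {0<..} \<tau> *\<^sub>R (f \<tau> / \<tau> powr (1 + 2 * s)))"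
  \<comment> \<open>The summand \<open>0\<close> gives the argument of \<open>F\<close> the shape of
    the affine substitution rules applied below.\<close>
  have eq: "indicat_real {0<..} \<tau> *\<^sub>R (f (\<tau> / R) / \<tau> powr (1 + 2 * s)) =
      R powr (- 1 - 2 * s) * F (0 + \<tau> / R)" for \<tau>
  proof (cases "0 < \<tau>")
    case True
    then have "R powr (- 1 - 2 * s) / (\<tau> / R) powr (1 + 2 * s) = 1 / \<tau> powr (1 + 2 * s)"
      using assms by (simp add: powr_divide powr_diff powr_add powr_minus field_simps)
    then show ?thesis using True assms by (simp add: F_def indicator_def field_simps)
  qed (use assms in \<open>auto simp: F_def indicator_def field_simps\<close>)
  show "kernel_integrable s (\<lambda>\<tau>. f (\<tau> / R))" if "kernel_integrable s f"
  proof -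
    have "integrable lebesgue (\<lambda>\<tau>. F (0 + (1 / R) * \<tau>))"
      using that assms unfolding kernel_integrable_def set_integrable_def F_def[symmetric]
      by (intro lebesgue_integrable_real_affine) auto
    then show ?thesis
      unfolding kernel_integrable_def set_integrable_def eq by simp
  qed
  have "R powr (- 2 * s) = R * R powr (- 1 - 2 * s)"
    using assms by (simp add: powr_diff powr_minus field_simps)
  moreover have "integral\<^sup>L lebesgue F = \<bar>1 / R\<bar> *\<^sub>R (LINT \<tau>|lebesgue. F (0 + (1 / R) * \<tau>))"
    using assms by (intro lebesgue_integral_real_affine) auto
  ultimately show "kernel_integral s (\<lambda>\<tau>. f (\<tau> / R)) = R powr (- 2 * s) * kernel_integral s f"
    using assms unfolding kernel_integral_def set_lebesgue_integral_def eq F_def[symmetric] by simp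
qed

section \<open>The function \<open>c\<close> and its zero\<close>

lemma powr_convex:
  fixes A :: real
  assumes "0 < A" "0 \<le> t" "t \<le> 1"
  shows "A powr ((1 - t) * x + t * y) \<le> (1 - t) * A powr x + t * A powr y"
proof -
  have "exp ((1 - t) *\<^sub>R (x * ln A) + t *\<^sub>R (y * ln A)) \<le> (1 - t) * exp (x * ln A) + t * exp (y * ln A)"
    using convex_onD[OF exp_convex, of t "x * ln A" "y * ln A"] assms by simp
  then show ?thesis using assms by (simp add: powr_def algebra_simps)
qed

text \<open>Convexity of \<open>x powr e\<close> in the exponent \<open>e\<close>, on the chord from
  \<open>e = 0\<close> to \<open>e = 1\<close>.\<close>

lemma powr_Bernoulli:
  fixes a x :: real
  assumes "0 < x" "0 \<le> a" "a \<le> 1"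
  shows "x powr a \<le> 1 + a * (x - 1)"
  using powr_convex[OF assms(1), of a 0 1] assms by (simp add: algebra_simps)

text \<open>Existence is the intermediate value theorem. For uniqueness, the smaller of two positive
  zeros would lie strictly between a point where \<open>f\<close> is negative and the larger zero,
  so convexity would make \<open>f\<close> negative there. Uniqueness gives sense to the description
  operator in \<open>gamma_tilde\<close>; continuity allows the exponent to be perturbed.\<close>

lemma convex_unique_zero:
  fixes f :: "real \<Rightarrow> real"
  assumes "convex_on {0..} f" "f 0 = 0" "0 < a" "f a < 0" "0 < b" "0 < f b"
  shows "continuous_on {0<..} f" "\<exists>!z. 0 < z \<and> f z = 0"
proof -
  have "convex_on {0<..} f"
    using assms(1) by (rule convex_on_subset) auto
  then show cont: "continuous_on {0<..} f"
    by (intro convex_on_continuous) auto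
  have le: "f ((1 - t) * x + t * y) \<le> (1 - t) * f x + t * f y" if "0 \<le> t" "t \<le> 1" "0 \<le> x" "0 \<le> y" for t x y
    using convex_onD[OF assms(1) that(1,2), of x y] that by simp
  have neg: "f x < 0" if "0 < x" "x \<le> a" for x
  proof -
    have "f x \<le> (x / a) * f a"
      using le[of "x / a" 0 a] that assms by simp
    also have "\<dots> < 0"
      using that assms by (intro mult_pos_neg) auto
    finally show ?thesis .
  qed
  have uniq: False if "0 < x" "x < y" "f x = 0" "f y = 0" for x y
  proof -
    \<comment> \<open>A point to the left of \<open>x\<close> where \<open>f\<close> is negative;
      \<open>t\<close> is the weight that writes \<open>x\<close> as a convex combination of
      \<open>z\<close> and \<open>y\<close>.\<close>
    define z where "z = min (x / 2) a"
    define t where "t = (x - z) / (y - z)"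
    have z: "0 < z" "z < x" "f z < 0"
      using that assms neg[of z] by (auto simp: z_def)
    have t: "0 \<le> t" "t < 1"
      using z that by (auto simp: t_def)
    have "(1 - t) * z + t * y = z + t * (y - z)"
      by (simp add: algebra_simps)
    also have "\<dots> = x"
      using z that by (simp add: t_def)
    finally have "f x \<le> (1 - t) * f z"
      using le[of t z y] t z that by simp
    also have "\<dots> < 0"
      using t z by (intro mult_pos_neg) auto
    finally show False using that by simp
  qed
  have ab: "a < b"
    using neg[of b] assms by force
  have "continuous_on {a..b} f"
    using cont by (rule continuous_on_subset) (use assms in auto)
  then obtain z where "a \<le> z" "z \<le> b" "f z = 0"
    using IVT'[of f a 0 b] assms ab by auto
  then show "\<exists>!z. 0 < z \<and> f z = 0"
    using assms uniq by (metis less_le_trans linorder_neqE_linordered_idom)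
qed

text \<open>For negative \<open>z\<close>, multiply by \<open>1 - z > 0\<close>: the left side
  becomes at most \<open>exp z * exp (- z) = 1\<close>, the right side becomes
  \<open>1 - z ^ 3\<close>, which exceeds \<open>1\<close>.\<close>

lemma exp_le_quadratic:
  fixes z :: real
  assumes "z \<le> 1"
  shows "exp z \<le> 1 + z + z\<^sup>2"
proof (cases "0 \<le> z")
  case True
  then show ?thesis using exp_bound assms by blast
next
  case False
  have "exp z * (1 - z) \<le> exp z * exp (- z)"
    using exp_ge_add_one_self[of "- z"] by (intro mult_left_mono) auto
  also have "\<dots> = 1"
    by (simp flip: exp_add)
  also have "1 \<le> (1 + z + z\<^sup>2) * (1 - z)"
  proof -
    have "(1 + z + z\<^sup>2) * (1 - z) = 1 - z ^ 3"
      by (simp add: algebra_simps power2_eq_square power3_eq_cube)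
    moreover have "z ^ 3 < 0" using False by simp
    ultimately show ?thesis by linarith
  qed
  finally show ?thesis
    using False mult_le_cancel_right_pos[of "1 - z"] by simp
qed

text \<open>\<open>|y + \<tau>\<xi>|\<^sup>2\<close> for unit vectors \<open>y\<close>, \<open>\<xi>\<close> with \<open>y \<bullet> \<xi> = b\<close>.\<close>

definition sq_dist :: "real \<Rightarrow> real \<Rightarrow> real"
  where "sq_dist b \<tau> = 1 + \<tau>\<^sup>2 + 2 * b * \<tau>"

definition second_diff :: "real \<Rightarrow> real \<Rightarrow> real \<Rightarrow> real"
  where "second_diff b \<gamma> \<tau> = sq_dist b \<tau> powr (- \<gamma> / 2) + sq_dist (- b) \<tau> powr (- \<gamma> / 2) - 2"

lemma c_fun_eq: "c_fun N s \<gamma> = kernel_integral s (second_diff (1 / sqrt (real N)) \<gamma>)"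
  by (simp add: c_fun_def kernel_integral_def second_diff_def sq_dist_def)

text \<open>Completing the square: the minimum over \<open>\<tau>\<close> is
  \<open>1 - b\<^sup>2\<close>. With \<open>b = 1 / sqrt N\<close> and \<open>N \<ge> 2\<close> the
  lines stay away from the origin, so negative powers of \<open>sq_dist\<close> are bounded and its
  logarithm is bounded below.\<close>

lemma sq_dist_ge:
  assumes "b\<^sup>2 \<le> 1 / 2"
  shows "1 / 2 \<le> sq_dist b \<tau>"
proof -
  have "sq_dist b \<tau> = (\<tau> + b)\<^sup>2 + (1 - b\<^sup>2)"
    by (simp add: sq_dist_def power2_eq_square algebra_simps)
  then show ?thesis using assms zero_le_power2[of "\<tau> + b"] by linarith
qed

lemma abs_ln_le:
  fixes x :: real
  assumes "1 / 2 \<le> x"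
  shows "\<bar>ln x\<bar> \<le> 2 * \<bar>x - 1\<bar>"
proof (cases "1 \<le> x")
  case True
  then show ?thesis using ln_le_minus_one[of x] by simp
next
  case False
  have "- ln x \<le> 1 / x - 1"
    using ln_le_minus_one[of "1 / x"] assms by (simp add: ln_div)
  also have "\<dots> \<le> 2 * (1 - x)"
  proof -
    have "1 / x - 1 = (1 - x) * (1 / x)" using assms by (simp add: field_simps)
    also have "\<dots> \<le> (1 - x) * 2" using assms False by (intro mult_left_mono) (auto simp: field_simps)
    finally show ?thesis by simp
  qed
  finally show ?thesis using False assms by simp
qed

section \<open>Logarithmic coefficients of the second difference\<close>

definition ln_sum :: "real \<Rightarrow> real \<Rightarrow> real"
  where "ln_sum b \<tau> = ln (sq_dist b \<tau>) + ln (sq_dist (- b) \<tau>)"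

text \<open>Expanding \<open>second_diff b (2 * k)\<close> in powers of \<open>k\<close>, the
  coefficient of \<open>k\<close> is \<open>- ln_sum b\<close> and that of \<open>k\<^sup>2\<close>
  is half of \<open>ln_sq_sum b\<close>.\<close>

definition ln_sq_sum :: "real \<Rightarrow> real \<Rightarrow> real"
  where "ln_sq_sum b \<tau> = (ln (sq_dist b \<tau>))\<^sup>2 + (ln (sq_dist (- b) \<tau>))\<^sup>2"

lemma sq_dist_measurable [measurable]: "sq_dist b \<in> borel_measurable borel"
  unfolding sq_dist_def by measurable

text \<open>Near \<open>0\<close>, \<open>sq_dist\<close> differs from \<open>1\<close> by at most a
  multiple of \<open>\<tau>\<close>; at infinity a logarithm grows more slowly than any
  power.\<close>

lemma ln_sq_bound:
  assumes "b\<^sup>2 \<le> 1 / 2" "0 < s" "0 < \<tau>"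
  shows "\<tau> < 1 \<Longrightarrow> (ln (sq_dist b \<tau>))\<^sup>2 \<le> 36 * \<tau>\<^sup>2"
    and "1 \<le> \<tau> \<Longrightarrow> (ln (sq_dist b \<tau>))\<^sup>2 \<le> 16 / s\<^sup>2 * 4 powr (s / 2) * \<tau> powr s"
proof -
  have b1: "\<bar>b\<bar> \<le> 1"
    using assms by (intro power2_le_imp_le[of "\<bar>b\<bar>" 1]) auto
  have bt: "\<bar>2 * b * \<tau>\<bar> \<le> 2 * \<tau>"
    using b1 assms by (simp add: abs_mult)
  note ge = sq_dist_ge[OF assms(1), of \<tau>]
  {
    assume "\<tau> < 1"
    then have "\<tau>\<^sup>2 \<le> \<tau>" using assms by (simp add: power2_eq_square)
    then have "\<bar>sq_dist b \<tau> - 1\<bar> \<le> 3 * \<tau>"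
      using bt zero_le_power2[of \<tau>] unfolding sq_dist_def by linarith
    then have "\<bar>ln (sq_dist b \<tau>)\<bar> \<le> 6 * \<tau>"
      using abs_ln_le[OF ge] by simp
    then have "(ln (sq_dist b \<tau>))\<^sup>2 \<le> (6 * \<tau>)\<^sup>2"
      using assms by (intro abs_le_square_iff[THEN iffD1]) auto
    then show "(ln (sq_dist b \<tau>))\<^sup>2 \<le> 36 * \<tau>\<^sup>2"
      by (simp add: power_mult_distrib)
  }
  {
    assume t: "1 \<le> \<tau>"
    then have t2: "1 \<le> \<tau>\<^sup>2" "\<tau> \<le> \<tau>\<^sup>2" using self_le_power[of \<tau> 2] one_le_power[of \<tau> 2] by auto
    have le: "sq_dist b \<tau> \<le> 4 * \<tau>\<^sup>2"
      using t2 bt unfolding sq_dist_def by (simp add: abs_le_iff)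
    have "ln (sq_dist b \<tau>) \<le> ln (4 * \<tau>\<^sup>2)"
      using le ge by (simp only: ln_le_cancel_iff)
    moreover have "- ln (sq_dist b \<tau>) \<le> ln (4 * \<tau>\<^sup>2)"
    proof -
      have "- ln (sq_dist b \<tau>) = ln (1 / sq_dist b \<tau>)"
        using ge by (simp add: ln_div)
      also have "\<dots> \<le> ln (4 * \<tau>\<^sup>2)"
        using ge t2 by (subst ln_le_cancel_iff) (auto simp: field_simps intro: order_trans[of 1 "sq_dist b \<tau> * 2"])
      finally show ?thesis .
    qed
    ultimately have "\<bar>ln (sq_dist b \<tau>)\<bar> \<le> ln (4 * \<tau>\<^sup>2)" by linarith
    \<comment> \<open>The exponent \<open>s / 4\<close> turns into growth
      \<open>\<tau> powr s\<close> after squaring, below the admissible order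
      \<open>2 * s\<close>.\<close>
    also have "\<dots> \<le> (4 * \<tau>\<^sup>2) powr (s / 4) / (s / 4)"
      using t2 assms by (intro ln_powr_bound) auto
    finally have "(ln (sq_dist b \<tau>))\<^sup>2 \<le> ((4 * \<tau>\<^sup>2) powr (s / 4) / (s / 4))\<^sup>2"
      using assms by (intro abs_le_square_iff[THEN iffD1]) auto
    also have "\<dots> = 16 / s\<^sup>2 * ((4 * \<tau>\<^sup>2) powr (s / 4))\<^sup>2"
      by (simp add: power_divide)
    also have "((4 * \<tau>\<^sup>2) powr (s / 4))\<^sup>2 = (4 * \<tau> powr 2) powr (s / 2)"
      using t by (simp add: power2_eq_square flip: powr_add)
    also have "\<dots> = 4 powr (s / 2) * \<tau> powr s"
      using t by (simp add: powr_mult powr_powr del: powr_numeral)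
    finally show "(ln (sq_dist b \<tau>))\<^sup>2 \<le> 16 / s\<^sup>2 * 4 powr (s / 2) * \<tau> powr s" by simp
  }
qed

text \<open>In the product the terms of first order in \<open>\<tau>\<close> cancel, and
  \<open>2 - 4 * b\<^sup>2\<close> lies between \<open>0\<close> and \<open>2\<close>. This makes
  \<open>ln_sum\<close> nonnegative and of order \<open>\<tau>\<^sup>2\<close> near
  \<open>0\<close>, although each logarithm is only of order \<open>\<tau>\<close>.\<close>

lemma sq_dist_mult_ge:
  assumes "b\<^sup>2 \<le> 1 / 2"
  shows "1 + \<tau> ^ 4 \<le> sq_dist b \<tau> * sq_dist (- b) \<tau>"
    and "sq_dist b \<tau> * sq_dist (- b) \<tau> \<le> 1 + 2 * \<tau>\<^sup>2 + \<tau> ^ 4"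
proof -
  have "sq_dist b \<tau> * sq_dist (- b) \<tau> = 1 + \<tau> ^ 4 + (2 - 4 * b\<^sup>2) * \<tau>\<^sup>2"
    by (simp add: sq_dist_def algebra_simps power2_eq_square power4_eq_xxxx)
  moreover have "0 \<le> (2 - 4 * b\<^sup>2) * \<tau>\<^sup>2" "(2 - 4 * b\<^sup>2) * \<tau>\<^sup>2 \<le> 2 * \<tau>\<^sup>2"
    using assms by (auto intro!: mult_nonneg_nonneg mult_right_mono)
  ultimately show "1 + \<tau> ^ 4 \<le> sq_dist b \<tau> * sq_dist (- b) \<tau>"
    "sq_dist b \<tau> * sq_dist (- b) \<tau> \<le> 1 + 2 * \<tau>\<^sup>2 + \<tau> ^ 4" by linarith+
qed

lemma ln_sum_eq:
  assumes "b\<^sup>2 \<le> 1 / 2"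
  shows "ln_sum b \<tau> = ln (sq_dist b \<tau> * sq_dist (- b) \<tau>)"
  using sq_dist_ge[of b \<tau>] sq_dist_ge[of "- b" \<tau>] assms by (simp add: ln_sum_def ln_mult)

lemma ln_sum_ge:
  assumes "b\<^sup>2 \<le> 1 / 2"
  shows "0 \<le> ln_sum b \<tau>" and "1 \<le> \<tau> \<Longrightarrow> ln 2 \<le> ln_sum b \<tau>"
proof -
  have "1 \<le> sq_dist b \<tau> * sq_dist (- b) \<tau>"
    using sq_dist_mult_ge(1)[OF assms, of \<tau>] by (smt (verit) zero_le_power_eq_numeral even_numeral)
  then show "0 \<le> ln_sum b \<tau>" by (simp add: ln_sum_eq[OF assms])
  assume "1 \<le> \<tau>"
  then have "1 \<le> \<tau> ^ 4" by simp
  then have "2 \<le> sq_dist b \<tau> * sq_dist (- b) \<tau>"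
    using sq_dist_mult_ge(1)[OF assms, of \<tau>] by linarith
  then show "ln 2 \<le> ln_sum b \<tau>" unfolding ln_sum_eq[OF assms] by (subst ln_le_cancel_iff) auto
qed

lemma kernel_integrable_ln_sq_sum:
  assumes "b\<^sup>2 \<le> 1 / 2" "0 < s" "s < 1"
  shows "kernel_integrable s (ln_sq_sum b)"
proof -
  define M where "M = 16 / s\<^sup>2 * 4 powr (s / 2)"
  show ?thesis
  proof (rule kernel_integrable_bound[where g = "\<lambda>\<tau>. 72 * (if \<tau> < 1 then \<tau>\<^sup>2 else 0) + 2 * M * (if \<tau> < 1 then 0 else \<tau> powr s)"])
    show "kernel_integrable s (\<lambda>\<tau>. 72 * (if \<tau> < 1 then \<tau>\<^sup>2 else 0) + 2 * M * (if \<tau> < 1 then 0 else \<tau> powr s))"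
      using assms by (intro kernel_integrable_add kernel_integrable_cmult kernel_integrable_near kernel_tail) auto
    show "ln_sq_sum b \<in> borel_measurable borel"
      unfolding ln_sq_sum_def by measurable
    fix \<tau> :: real assume t: "0 < \<tau>"
    show "\<bar>ln_sq_sum b \<tau>\<bar> \<le> 72 * (if \<tau> < 1 then \<tau>\<^sup>2 else 0) + 2 * M * (if \<tau> < 1 then 0 else \<tau> powr s)"
      using ln_sq_bound[OF assms(1,2) t] ln_sq_bound[of "- b", OF _ assms(2) t] assms
      unfolding ln_sq_sum_def M_def[symmetric] by (cases "\<tau> < 1") auto
  qed
qed

text \<open>Near \<open>0\<close> the product bound and \<open>ln z \<le> z - 1\<close> give
  \<open>3 * \<tau>\<^sup>2\<close>; from \<open>1\<close> on, \<open>z \<le> 1 + z\<^sup>2\<close>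
  reduces to the squared logarithms.\<close>

lemma kernel_integrable_ln_sum:
  assumes "b\<^sup>2 \<le> 1 / 2" "0 < s" "s < 1"
  shows "kernel_integrable s (ln_sum b)"
proof (rule kernel_integrable_bound[where g = "\<lambda>\<tau>. (3 * (if \<tau> < 1 then \<tau>\<^sup>2 else 0) + 2 * (if \<tau> < 1 then 0 else \<tau> powr 0)) + ln_sq_sum b \<tau>"])
  show "kernel_integrable s (\<lambda>\<tau>. (3 * (if \<tau> < 1 then \<tau>\<^sup>2 else 0) + 2 * (if \<tau> < 1 then 0 else \<tau> powr 0)) + ln_sq_sum b \<tau>)"
    using assms by (intro kernel_integrable_add kernel_integrable_cmult kernel_integrable_near kernel_tail
      kernel_integrable_ln_sq_sum) auto
  show "ln_sum b \<in> borel_measurable borel"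
    unfolding ln_sum_def by measurable
  fix \<tau> :: real assume t: "0 < \<tau>"
  have nn: "0 \<le> ln_sq_sum b \<tau>" by (simp add: ln_sq_sum_def)
  show "\<bar>ln_sum b \<tau>\<bar> \<le> (3 * (if \<tau> < 1 then \<tau>\<^sup>2 else 0) + 2 * (if \<tau> < 1 then 0 else \<tau> powr 0)) + ln_sq_sum b \<tau>"
  proof (cases "\<tau> < 1")
    case True
    have "\<tau> ^ 4 = \<tau>\<^sup>2 * \<tau>\<^sup>2" by (simp flip: power_add)
    also have "\<dots> \<le> 1 * \<tau>\<^sup>2" using True t by (intro mult_right_mono) (auto simp: power2_eq_square mult_le_one)
    finally have p: "\<tau> ^ 4 \<le> \<tau>\<^sup>2" by simp
    have "0 < sq_dist b \<tau> * sq_dist (- b) \<tau>"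
      using sq_dist_ge[OF assms(1), of \<tau>] sq_dist_ge[of "- b" \<tau>] assms by (intro mult_pos_pos) auto
    then have "ln_sum b \<tau> \<le> sq_dist b \<tau> * sq_dist (- b) \<tau> - 1"
      unfolding ln_sum_eq[OF assms(1)] by (rule ln_le_minus_one)
    also have "\<dots> \<le> 3 * \<tau>\<^sup>2" using sq_dist_mult_ge(2)[OF assms(1), of \<tau>] p by linarith
    finally show ?thesis using True ln_sum_ge(1)[OF assms(1), of \<tau>] nn by simp
  next
    case False
    have "z \<le> 1 + z\<^sup>2" for z :: real
      using zero_le_power2[of "z - 1"] zero_le_power2[of z] unfolding power2_diff one_power2 by linarith
    from this[of "ln (sq_dist b \<tau>)"] this[of "ln (sq_dist (- b) \<tau>)"] have "ln_sum b \<tau> \<le> 2 + ln_sq_sum b \<tau>"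
      by (simp add: ln_sum_def ln_sq_sum_def)
    then show ?thesis using False t ln_sum_ge(1)[OF assms(1), of \<tau>] by simp
  qed
qed

section \<open>Integrability, convexity and sign of the kernel integral as a function of the
  exponent\<close>

lemma second_diff_exp:
  assumes "b\<^sup>2 \<le> 1 / 2"
  shows "second_diff b (2 * k) \<tau> = exp (- k * ln (sq_dist b \<tau>)) + exp (- k * ln (sq_dist (- b) \<tau>)) - 2"
  using sq_dist_ge[of b \<tau>] sq_dist_ge[of "- b" \<tau>] assms by (simp add: second_diff_def powr_def)

lemma abs_exp_taylor:
  fixes z :: real
  shows "\<bar>exp z - 1 - z\<bar> \<le> exp \<bar>z\<bar> * z\<^sup>2"
proof -
  obtain t where t: "\<bar>t\<bar> \<le> \<bar>z\<bar>" "exp z = (\<Sum>m<2. z ^ m / fact m) + exp t / fact 2 * z ^ 2"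
    using Maclaurin_exp_le by blast
  then have "exp z - 1 - z = exp t / 2 * z\<^sup>2"
    by (simp add: numeral_2_eq_2)
  moreover have "0 \<le> exp t / 2 * z\<^sup>2" by simp
  ultimately have "\<bar>exp z - 1 - z\<bar> = exp t / 2 * z\<^sup>2" by (simp only: abs_of_nonneg)
  also have "exp t / 2 \<le> exp \<bar>z\<bar>" using t by (smt (verit) exp_le_cancel_iff exp_gt_zero field_sum_of_halves)
  then have "exp t / 2 * z\<^sup>2 \<le> exp \<bar>z\<bar> * z\<^sup>2" by (intro mult_right_mono) auto
  finally show ?thesis .
qed

text \<open>For \<open>\<tau> < 1\<close>, Taylor expansion in the logarithms leaves
  \<open>ln_sum\<close> as linear term and \<open>ln_sq_sum\<close> as remainder, both integrable
  against the kernel. For \<open>\<tau> \<ge> 1\<close> each power is at most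
  \<open>2 powr k\<close>, since \<open>sq_dist\<close> is at least \<open>1 / 2\<close>.\<close>

lemma kernel_integrable_second_diff:
  assumes "b\<^sup>2 \<le> 1 / 2" "0 < s" "s < 1" "0 \<le> \<gamma>"
  shows "kernel_integrable s (second_diff b \<gamma>)"
proof -
  define k where "k = \<gamma> / 2"
  \<comment> \<open>The Taylor remainder constant: for \<open>\<tau> < 1\<close> the logarithms are
    at most \<open>ln 4\<close> in modulus.\<close>
  define M where "M = exp (k * ln 4) * k\<^sup>2"
  have k: "\<gamma> = 2 * k" "0 \<le> k" using assms by (auto simp: k_def)
  have b': "(- b)\<^sup>2 \<le> 1 / 2" using assms by simp
  have b1: "\<bar>b\<bar> \<le> 1"
    using assms by (intro power2_le_imp_le[of "\<bar>b\<bar>" 1]) auto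
  show ?thesis
  proof (rule kernel_integrable_bound[where g = "\<lambda>\<tau>. (k * ln_sum b \<tau> + M * ln_sq_sum b \<tau>) + (2 * 2 powr k + 2) * (if \<tau> < 1 then 0 else \<tau> powr 0)"])
    show "kernel_integrable s (\<lambda>\<tau>. (k * ln_sum b \<tau> + M * ln_sq_sum b \<tau>) + (2 * 2 powr k + 2) * (if \<tau> < 1 then 0 else \<tau> powr 0))"
      using assms by (intro kernel_integrable_add kernel_integrable_cmult kernel_tail
        kernel_integrable_ln_sq_sum kernel_integrable_ln_sum) auto
    show "second_diff b \<gamma> \<in> borel_measurable borel"
      unfolding second_diff_def by measurable
    fix \<tau> :: real assume t: "0 < \<tau>"
    show "\<bar>second_diff b \<gamma> \<tau>\<bar> \<le> (k * ln_sum b \<tau> + M * ln_sq_sum b \<tau>) + (2 * 2 powr k + 2) * (if \<tau> < 1 then 0 else \<tau> powr 0)"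
    proof (cases "\<tau> < 1")
      case True
      have le: "\<bar>exp (- k * ln (sq_dist c \<tau>)) - 1 - (- k * ln (sq_dist c \<tau>))\<bar> \<le> M * (ln (sq_dist c \<tau>))\<^sup>2"
        if c: "c\<^sup>2 \<le> 1 / 2" "\<bar>c\<bar> \<le> 1" for c
      proof -
        have "\<bar>c * \<tau>\<bar> \<le> 1" "\<tau>\<^sup>2 \<le> 1" using c True t by (auto simp: abs_mult mult_le_one power2_eq_square)
        then have "sq_dist c \<tau> \<le> 4" by (auto simp: sq_dist_def abs_le_iff)
        moreover have "1 / 4 \<le> sq_dist c \<tau>" using sq_dist_ge[OF c(1), of \<tau>] by simp
        ultimately have "ln (sq_dist c \<tau>) \<le> ln 4" "ln (1 / 4) \<le> ln (sq_dist c \<tau>)"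
          by (subst ln_le_cancel_iff; auto)+
        then have "\<bar>ln (sq_dist c \<tau>)\<bar> \<le> ln 4" by (auto simp: abs_le_iff ln_div)
        then have "\<bar>- k * ln (sq_dist c \<tau>)\<bar> \<le> k * ln 4"
          using k by (auto simp: abs_mult mult_left_mono)
        then have "exp \<bar>- k * ln (sq_dist c \<tau>)\<bar> * (- k * ln (sq_dist c \<tau>))\<^sup>2 \<le> exp (k * ln 4) * (- k * ln (sq_dist c \<tau>))\<^sup>2"
          by (intro mult_right_mono) auto
        also have "\<dots> = M * (ln (sq_dist c \<tau>))\<^sup>2" by (simp add: M_def power_mult_distrib)
        finally show ?thesis using abs_exp_taylor[of "- k * ln (sq_dist c \<tau>)"] by linarith
      qed
      have "0 \<le> k * ln_sum b \<tau>" using k ln_sum_ge(1)[OF assms(1), of \<tau>] by simp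
      then show ?thesis
        using le[OF assms(1) b1] le[of "- b"] assms(1) b1 True
        unfolding k(1) second_diff_exp[OF assms(1)] ln_sum_def ln_sq_sum_def
        by (simp add: algebra_simps)
    next
      case False
      have le: "sq_dist c \<tau> powr (- \<gamma> / 2) \<le> 2 powr k" if "c\<^sup>2 \<le> 1 / 2" for c
      proof -
        have "sq_dist c \<tau> powr (- \<gamma> / 2) \<le> (1 / 2) powr (- \<gamma> / 2)"
          using sq_dist_ge[OF that, of \<tau>] assms by (intro powr_mono2') auto
        then show ?thesis by (simp add: k powr_minus powr_divide)
      qed
      have "0 \<le> k * ln_sum b \<tau>" "0 \<le> M * ln_sq_sum b \<tau>"
        using k ln_sum_ge(1)[OF assms(1), of \<tau>] by (auto simp: M_def ln_sq_sum_def)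
      moreover have "\<bar>second_diff b \<gamma> \<tau>\<bar> \<le> 2 * 2 powr k + 2"
        using le[OF assms(1)] le[OF b'] powr_ge_zero[of "sq_dist b \<tau>" "- \<gamma> / 2"] powr_ge_zero[of "sq_dist (- b) \<tau>" "- \<gamma> / 2"]
        unfolding second_diff_def by linarith
      ultimately show ?thesis using False t by simp
    qed
  qed
qed

text \<open>For each fixed \<open>\<tau>\<close> the integrand is a sum of exponentials in
  \<open>\<gamma>\<close>, hence convex, and integration preserves this.\<close>

lemma convex_kernel_second_diff:
  assumes "b\<^sup>2 \<le> 1 / 2" "0 < s" "s < 1"
  shows "convex_on {0..} (\<lambda>\<gamma>. kernel_integral s (second_diff b \<gamma>))"
proof (rule convex_onI)
  fix t x y :: real
  assume t: "0 < t" "t < 1" and xy: "x \<in> {0..}" "y \<in> {0..}"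
  note i = kernel_integrable_second_diff[OF assms]
  have le: "second_diff b ((1 - t) * x + t * y) \<tau> \<le> (1 - t) * second_diff b x \<tau> + t * second_diff b y \<tau>" for \<tau>
  proof -
    have p: "sq_dist c \<tau> powr (- ((1 - t) * x + t * y) / 2) \<le>
        (1 - t) * sq_dist c \<tau> powr (- x / 2) + t * sq_dist c \<tau> powr (- y / 2)" if "c\<^sup>2 \<le> 1 / 2" for c
    proof -
      have "(1 - t) * (- x / 2) + t * (- y / 2) = - ((1 - t) * x + t * y) / 2"
        by (simp add: field_simps)
      moreover have "0 < sq_dist c \<tau>"
        using sq_dist_ge[OF that, of \<tau>] by linarith
      ultimately show ?thesis
        using powr_convex[of "sq_dist c \<tau>" t "- x / 2" "- y / 2"] t by (simp only: less_imp_le)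
    qed
    show ?thesis
      using p[of b] p[of "- b"] assms(1) unfolding second_diff_def
      by (simp add: algebra_simps)
  qed
  have "kernel_integral s (second_diff b ((1 - t) * x + t * y)) \<le>
      kernel_integral s (\<lambda>\<tau>. (1 - t) * second_diff b x \<tau> + t * second_diff b y \<tau>)"
    using t xy le by (intro kernel_integral_mono kernel_integrable_add kernel_integrable_cmult i) auto
  also have "\<dots> = (1 - t) * kernel_integral s (second_diff b x) + t * kernel_integral s (second_diff b y)"
    using xy by (simp add: kernel_integral_lincomb i)
  finally show "kernel_integral s (second_diff b ((1 - t) *\<^sub>R x + t *\<^sub>R y)) \<le>
      (1 - t) * kernel_integral s (second_diff b x) + t * kernel_integral s (second_diff b y)" by simp
qed (rule convex_real_interval)

lemma kernel_ln_sum_pos: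
  assumes "b\<^sup>2 \<le> 1 / 2" "0 < s" "s < 1"
  shows "0 < kernel_integral s (ln_sum b)"
proof -
  have "0 < ln 2 * (1 / (2 * s))" using assms by simp
  also have "\<dots> = kernel_integral s (\<lambda>\<tau>. ln 2 * (if \<tau> < 1 then 0 else \<tau> powr 0))"
    unfolding kernel_integral_cmult using assms by (subst kernel_tail(2)) auto
  also have "\<dots> \<le> kernel_integral s (ln_sum b)"
    using assms ln_sum_ge[OF assms(1)]
    by (intro kernel_integral_mono kernel_integrable_cmult kernel_tail kernel_integrable_ln_sum) auto
  finally show ?thesis .
qed

text \<open>With \<open>\<gamma> = 2k\<close>, Taylor expansion of the exponentials in \<open>second_diff_exp\<close> gives
  \<open>-kL + k\<^sup>2q \<le> c(2k) \<le> -kL + k\<^sup>2Q\<close> with \<open>L, q > 0\<close>, the upper bound for \<open>k \<le> 1\<close> only: this fixes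
  the sign of \<open>c\<close> for small and for large exponents.\<close>

lemma kernel_second_diff_neg:
  assumes "b\<^sup>2 \<le> 1 / 2" "0 < s" "s < 1"
  obtains \<gamma> where "0 < \<gamma>" "kernel_integral s (second_diff b \<gamma>) < 0"
proof -
  define L where "L = kernel_integral s (ln_sum b)"
  define Q where "Q = kernel_integral s (ln_sq_sum b)"
  \<comment> \<open>Small enough that the linear term wins, \<open>k * Q < L\<close>, and that
    \<open>k \<le> 1\<close>.\<close>
  define k where "k = L / (Q + L + 1)"
  have L: "0 < L" unfolding L_def by (rule kernel_ln_sum_pos[OF assms])
  have "kernel_integral s (\<lambda>\<tau>. 0 * ln_sq_sum b \<tau>) \<le> Q"
    unfolding Q_def using assms
    by (intro kernel_integral_mono kernel_integrable_cmult kernel_integrable_ln_sq_sum) (auto simp: ln_sq_sum_def)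
  then have Q: "0 \<le> Q" by simp
  have k: "0 < k" "k \<le> 1" "k * Q < L"
    using L Q by (auto simp: k_def field_simps intro: add_nonneg_pos)
  have le: "exp (- k * ln (sq_dist c \<tau>)) \<le> 1 - k * ln (sq_dist c \<tau>) + k\<^sup>2 * (ln (sq_dist c \<tau>))\<^sup>2"
    if "c\<^sup>2 \<le> 1 / 2" for c \<tau>
  proof -
    \<comment> \<open>The quadratic upper bound for \<open>exp\<close> requires an argument at most
      \<open>1\<close>, which follows from \<open>k \<le> 1\<close> and
      \<open>ln 2 < 1\<close>.\<close>
    have "ln (1 / 2) \<le> ln (sq_dist c \<tau>)"
      using sq_dist_ge[OF that, of \<tau>] by (subst ln_le_cancel_iff) auto
    then have "- ln (sq_dist c \<tau>) \<le> 1" using ln_2_less_1 by (simp add: ln_div)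
    then have "k * - ln (sq_dist c \<tau>) \<le> 1 * 1"
      using k mult_left_mono[of "- ln (sq_dist c \<tau>)" 1 k] by linarith
    then show ?thesis
      using exp_le_quadratic[of "- k * ln (sq_dist c \<tau>)"] by (simp add: power_mult_distrib)
  qed
  have "kernel_integral s (second_diff b (2 * k)) \<le>
      kernel_integral s (\<lambda>\<tau>. (- k) * ln_sum b \<tau> + k\<^sup>2 * ln_sq_sum b \<tau>)"
  proof (intro kernel_integral_mono kernel_integrable_add kernel_integrable_cmult
      kernel_integrable_ln_sq_sum kernel_integrable_ln_sum kernel_integrable_second_diff)
    fix \<tau> :: real
    show "second_diff b (2 * k) \<tau> \<le> (- k) * ln_sum b \<tau> + k\<^sup>2 * ln_sq_sum b \<tau>"
      using le[of b \<tau>] le[of "- b" \<tau>] assms(1)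
      unfolding second_diff_exp[OF assms(1)] ln_sum_def ln_sq_sum_def by (simp add: algebra_simps)
  qed (use assms k in auto)
  also have "\<dots> = - k * L + k\<^sup>2 * Q"
    unfolding L_def Q_def using assms
    by (simp only: kernel_integral_lincomb kernel_integrable_ln_sq_sum kernel_integrable_ln_sum)
  also have "\<dots> = k * (k * Q - L)" by (simp add: power2_eq_square algebra_simps)
  also have "\<dots> < 0" using k by (intro mult_pos_neg) auto
  finally show ?thesis using that[of "2 * k"] k by simp
qed

text \<open>Since \<open>b > 0\<close>, the line in the direction \<open>- b\<close> first enters
  the unit ball. There \<open>sq_dist (- b) \<tau> < 1\<close>, so its negative power grows with the
  exponent, and the quadratic Taylor term gained on \<open>b / 2 \<le> \<tau> < b\<close> beats the
  linear loss for large \<open>k\<close>.\<close>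

lemma kernel_second_diff_pos:
  assumes "0 < b" "b\<^sup>2 \<le> 1 / 2" "0 < s" "s < 1"
  obtains \<gamma> where "0 < \<gamma>" "0 < kernel_integral s (second_diff b \<gamma>)"
proof -
  define L where "L = kernel_integral s (ln_sum b)"
  \<comment> \<open>On that interval \<open>- ln (sq_dist (- b) \<tau>)\<close> is at least
    \<open>b\<^sup>2 / 2\<close>; \<open>d\<close> is half the square of this bound.\<close>
  define d where "d = (b\<^sup>2 / 2)\<^sup>2 / 2"
  \<comment> \<open>The indicator of \<open>b / 2 \<le> \<tau> < b\<close> for positive
    \<open>\<tau>\<close>, written as a difference of two tails so that its kernel integral is
    explicit.\<close>
  define J where "J = (\<lambda>\<tau>::real. (if \<tau> < b / 2 then 0 else \<tau> powr 0) - (if \<tau> < b then 0 else \<tau> powr 0))"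
  define q where "q = d * kernel_integral s J"
  \<comment> \<open>Chosen so that \<open>k * q - L = 1\<close>.\<close>
  define k where "k = (L + 1) / q"
  have L: "0 < L" unfolding L_def by (rule kernel_ln_sum_pos[OF assms(2-)])
  have "0 < b / 2" "0 < 2 * s" using assms by auto
  note tail1 = kernel_tail[OF \<open>0 < s\<close> this] and tail2 = kernel_tail[OF \<open>0 < s\<close> \<open>0 < b\<close> this(2)]
  have Ji: "kernel_integrable s J"
    unfolding J_def using assms by (intro kernel_integrable_diff kernel_tail) auto
  have "kernel_integral s J = (b / 2) powr (0 - 2 * s) / (2 * s - 0) - b powr (0 - 2 * s) / (2 * s - 0)"
    unfolding J_def by (simp only: kernel_integral_diff[OF tail1(1) tail2(1)] tail1(2) tail2(2))
  also have "\<dots> > 0"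
    using powr_less_mono2_neg[of "- 2 * s" "b / 2" b] assms by (simp add: divide_strict_right_mono)
  finally have q: "0 < q" using assms by (simp add: q_def d_def)
  then have k: "0 < k" "0 < k * q - L" using L by (auto simp: k_def)
  have ge: "1 + z \<le> exp z" for z :: real by (rule exp_ge_add_one_self)
  have "kernel_integral s (\<lambda>\<tau>. (- k) * ln_sum b \<tau> + k\<^sup>2 * d * J \<tau>) \<le> kernel_integral s (second_diff b (2 * k))"
  proof (intro kernel_integral_mono kernel_integrable_add kernel_integrable_cmult
      kernel_integrable_ln_sum kernel_integrable_second_diff Ji)
    fix \<tau> :: real assume t: "0 < \<tau>"
    have "- k * ln (sq_dist (- b) \<tau>) + 1 + k\<^sup>2 * d * J \<tau> \<le> exp (- k * ln (sq_dist (- b) \<tau>))"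
    proof (cases "b / 2 \<le> \<tau> \<and> \<tau> < b")
      case True
      define z where "z = - ln (sq_dist (- b) \<tau>)"
      have "b / 2 * b \<le> \<tau> * (2 * b - \<tau>)"
        using True assms by (intro mult_mono) auto
      then have "b\<^sup>2 / 2 \<le> 1 - sq_dist (- b) \<tau>"
        by (simp add: sq_dist_def power2_eq_square algebra_simps)
      also have "\<dots> \<le> z"
        using ln_le_minus_one[of "sq_dist (- b) \<tau>"] sq_dist_ge[of "- b" \<tau>] assms by (simp add: z_def)
      finally have z: "b\<^sup>2 / 2 \<le> z" .
      then have z0: "0 \<le> z" using zero_le_power2[of b] by linarith
      have "(b\<^sup>2 / 2)\<^sup>2 \<le> z\<^sup>2" using z by (intro power_mono) auto
      then have "k\<^sup>2 * (b\<^sup>2 / 2)\<^sup>2 \<le> k\<^sup>2 * z\<^sup>2" by (intro mult_left_mono) auto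
      then have "k\<^sup>2 * d \<le> (k * z)\<^sup>2 / 2" by (simp add: d_def power_mult_distrib)
      moreover have "1 + k * z + (k * z)\<^sup>2 / 2 \<le> exp (k * z)"
        using k z0 by (intro exp_lower_Taylor_quadratic) auto
      ultimately show ?thesis using True t assms by (auto simp: J_def z_def)
    next
      case False
      then have "J \<tau> = 0" using t assms by (auto simp: J_def)
      then show ?thesis using ge[of "- k * ln (sq_dist (- b) \<tau>)"] by simp
    qed
    then show "(- k) * ln_sum b \<tau> + k\<^sup>2 * d * J \<tau> \<le> second_diff b (2 * k) \<tau>"
      using ge[of "- k * ln (sq_dist b \<tau>)"]
      unfolding second_diff_exp[OF assms(2)] ln_sum_def by (simp add: algebra_simps)
  qed (use assms k in auto)
  moreover have "kernel_integral s (\<lambda>\<tau>. (- k) * ln_sum b \<tau> + k\<^sup>2 * d * J \<tau>) = - k * L + k\<^sup>2 * d * kernel_integral s J"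
    unfolding L_def using assms Ji
    by (simp only: kernel_integral_lincomb kernel_integrable_ln_sum)
  moreover have "- k * L + k\<^sup>2 * d * kernel_integral s J = k * (k * q - L)"
    by (simp add: q_def power2_eq_square algebra_simps)
  moreover have "0 < k * (k * q - L)" using k by simp
  ultimately have "0 < kernel_integral s (second_diff b (2 * k))" by linarith
  then show ?thesis using that[of "2 * k"] k by simp
qed

text \<open>With convexity, the value \<open>0\<close> at \<open>0\<close> and both signs
  established, \<open>c_fun N s\<close> has exactly one positive zero, so the description in
  \<open>gamma_tilde\<close> denotes it.\<close>

lemma c_fun_gamma_tilde:
  assumes "2 \<le> N" "0 < s" "s < 1"
  shows "continuous_on {0<..} (c_fun N s)" "0 < gamma_tilde N s" "c_fun N s (gamma_tilde N s) = 0"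
proof -
  define b where "b = 1 / sqrt (real N)"
  have b: "0 < b" "b\<^sup>2 \<le> 1 / 2" using assms by (auto simp: b_def power_divide field_simps)
  have eq: "c_fun N s = (\<lambda>\<gamma>. kernel_integral s (second_diff b \<gamma>))"
    by (auto simp: c_fun_eq b_def)
  obtain x where x: "0 < x" "c_fun N s x < 0"
    using kernel_second_diff_neg[OF b(2) assms(2,3)] unfolding eq by auto
  obtain y where y: "0 < y" "0 < c_fun N s y"
    using kernel_second_diff_pos[OF b assms(2,3)] unfolding eq by auto
  \<comment> \<open>\<open>0 powr 0\<close> is \<open>0\<close>, so the powers with exponent
    \<open>0\<close> equal \<open>1\<close> only because \<open>sq_dist\<close> never
    vanishes.\<close>
  have "sq_dist c t \<noteq> 0" if "c\<^sup>2 \<le> 1 / 2" for c t using sq_dist_ge[OF that, of t] by auto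
  from this[of b] this[of "- b"] have "second_diff b 0 t = 0 * t" for t using b(2) by (auto simp: second_diff_def)
  then have "second_diff b 0 = (\<lambda>t. 0 * t)" by auto
  then have 0: "c_fun N s 0 = 0" unfolding eq by simp
  have cv: "convex_on {0..} (c_fun N s)" unfolding eq by (rule convex_kernel_second_diff[OF b(2) assms(2,3)])
  note u = convex_unique_zero[OF cv 0 x y]
  show "continuous_on {0<..} (c_fun N s)" by (rule u(1))
  show "0 < gamma_tilde N s" "c_fun N s (gamma_tilde N s) = 0"
    using theI'[OF u(2)] unfolding gamma_tilde_def by auto
qed

text \<open>The kernel integral of \<open>(2\<tau>)\<^sup>-\<^sup>\<gamma>\<close> over \<open>\<tau> \<ge> r\<close>.\<close>

definition loss :: "real \<Rightarrow> real \<Rightarrow> real \<Rightarrow> real"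
  where "loss r s \<gamma> = 2 powr (- \<gamma>) * (r powr (- \<gamma> - 2 * s) / (2 * s + \<gamma>))"

text \<open>At \<open>gamma_tilde\<close> the left side is zero and \<open>loss\<close> is positive.
  By continuity the strict inequality survives slightly to the right, which is what allows an
  exponent beyond the critical one.\<close>

lemma c_fun_less_loss:
  assumes "2 \<le> N" "0 < s" "s < 1" "0 < r"
  obtains \<gamma> where "gamma_tilde N s < \<gamma>" "real N * c_fun N s \<gamma> < loss r s \<gamma>"
proof -
  define z where "z = gamma_tilde N s"
  define h where "h = (\<lambda>\<gamma>. loss r s \<gamma> - real N * c_fun N s \<gamma>)"
  note c = c_fun_gamma_tilde[OF assms(1-3), folded z_def]
  have "continuous_on {0<..} h"
    unfolding h_def loss_def using assms by (intro continuous_intros c(1)) auto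
  then have "isCont h z" using c(2) by (simp add: continuous_on_eq_continuous_at)
  moreover have "0 < h z" using c assms by (simp add: h_def loss_def)
  ultimately have "eventually (\<lambda>x. 0 < h x) (at z)"
    unfolding isCont_def by (rule order_tendstoD)
  then have "eventually (\<lambda>x. 0 < h x) (at_right z)"
    by (rule filter_leD[OF at_le, rotated]) auto
  then obtain e where "z < e" "\<And>y. z < y \<Longrightarrow> y < e \<Longrightarrow> 0 < h y"
    unfolding eventually_at_right_field by auto
  then show ?thesis using that[of "(z + e) / 2"] by (simp add: h_def z_def)
qed

section \<open>Orthonormal bases\<close>

lemma orthonormal_bases_finite:
  fixes B :: "'a::euclidean_space set"
  assumes "B \<in> orthonormal_bases"
  shows "finite B" "card B \<le> DIM('a)"
proof -
  have "independent B"
    using assms by (intro pairwise_orthogonal_independent) (auto simp: orthonormal_bases_def)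
  then show "finite B" "card B \<le> DIM('a)" using independent_bound by blast+
qed

lemma Basis_orthonormal_bases: "Basis \<in> orthonormal_bases"
  by (auto simp: orthonormal_bases_def pairwise_def orthogonal_def inner_Basis)

text \<open>The reflection exchanging \<open>y\<close> with the normalized diagonal carries the
  standard basis to one making equal angles with \<open>y\<close>. The last claim is a pigeonhole
  argument: the squared components of a unit vector sum to \<open>1\<close>, so one of them is at
  least \<open>1 / DIM('a)\<close>.\<close>

lemma equiangular_basis:
  fixes y :: "'a::euclidean_space"
  assumes "norm y = 1"
  obtains B where "B \<in> orthonormal_bases" "card B = DIM('a)"
    "\<And>\<xi>. \<xi> \<in> B \<Longrightarrow> \<xi> \<bullet> y = 1 / sqrt DIM('a)"
    "\<And>e. norm e = 1 \<Longrightarrow> \<exists>\<xi>\<in>B. 1 / sqrt DIM('a) \<le> \<bar>\<xi> \<bullet> e\<bar>"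
proof -
  define a :: 'a where "a = (1 / sqrt DIM('a)) *\<^sub>R \<Sum>Basis"
  define v where "v = a - y"
  \<comment> \<open>Reflection in the hyperplane orthogonal to \<open>v\<close>; for
    \<open>v = 0\<close> it is the identity.\<close>
  define f where "f x = x - (2 * (x \<bullet> v) / (v \<bullet> v)) *\<^sub>R v" for x
  have ab: "a \<bullet> b = 1 / sqrt DIM('a)" if "b \<in> Basis" for b
    using that by (simp add: a_def inner_sum_left inner_Basis sum.delta)
  have "a \<bullet> a = (\<Sum>b\<in>Basis. (a \<bullet> b) * (a \<bullet> b))" by (rule euclidean_inner)
  also have "\<dots> = (\<Sum>b\<in>(Basis :: 'a set). 1 / real DIM('a))"
    by (intro sum.cong) (auto simp: ab)
  also have "\<dots> = 1" by simp
  finally have aa: "a \<bullet> a = 1" .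
  have yy: "y \<bullet> y = 1" using assms by (simp add: norm_eq_1)
  \<comment> \<open>Both identities express that \<open>a\<close> and \<open>y\<close> have the same
    length.\<close>
  have vv: "v \<bullet> v = 2 * (a \<bullet> v)" "v \<bullet> v = - 2 * (y \<bullet> v)"
    by (simp_all add: v_def inner_diff inner_commute aa yy)
  have fa: "f a = y"
  proof (cases "v = 0")
    case True then show ?thesis by (simp add: f_def v_def)
  next
    case False
    then have "v \<bullet> v \<noteq> 0" by simp
    then have "(v \<bullet> v) / (v \<bullet> v) = 1" by (rule divide_self)
    then have "2 * (a \<bullet> v) / (v \<bullet> v) = 1" by (simp only: vv(1)[symmetric])
    then have "f a = a - v" by (simp only: f_def scaleR_one)
    then show ?thesis by (simp add: v_def)
  qed
  have self_adj: "f x \<bullet> z = x \<bullet> f z" for x z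
    by (simp add: f_def inner_diff inner_commute)
  have ff: "f (f x) = x" for x
  proof (cases "v = 0")
    case False
    then have "f x \<bullet> v = - (x \<bullet> v)" by (simp add: f_def inner_diff)
    then have "f (f x) = f x + (2 * (x \<bullet> v) / (v \<bullet> v)) *\<^sub>R v" by (simp add: f_def[of "f x"])
    then show ?thesis by (simp add: f_def)
  qed (simp add: f_def)
  have iso: "f x \<bullet> f z = x \<bullet> z" for x z by (simp add: self_adj ff)
  have "linear f"
    unfolding f_def by (intro linearI) (auto simp: inner_add_left algebra_simps add_divide_distrib)
  have inj: "inj f" by (metis ff injI)
  show ?thesis
  proof (rule that[of "f ` Basis"])
    have "span (f ` Basis) = f ` span Basis"
      using \<open>linear f\<close> linear_span_image by blast
    also have "\<dots> = UNIV" using ff by (metis span_Basis surj_def)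
    finally show "f ` Basis \<in> orthonormal_bases"
      by (auto simp: orthonormal_bases_def pairwise_def orthogonal_def iso inner_Basis norm_eq_1)
    show "card (f ` Basis) = DIM('a)"
      using inj by (intro card_image) (auto intro: inj_on_subset)
    show "\<xi> \<bullet> y = 1 / sqrt DIM('a)" if "\<xi> \<in> f ` Basis" for \<xi>
      using that ab by (auto simp: fa[symmetric] iso inner_commute)
    fix e :: 'a assume "norm e = 1"
    then have 1: "(\<Sum>b\<in>Basis. (f e \<bullet> b)\<^sup>2) = 1"
      using euclidean_inner[of "f e" "f e"] by (simp add: power2_eq_square iso norm_eq_1)
    show "\<exists>\<xi>\<in>f ` Basis. 1 / sqrt DIM('a) \<le> \<bar>\<xi> \<bullet> e\<bar>"
    proof (rule ccontr)
      assume neg: "\<not> ?thesis"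
      have "(f e \<bullet> b)\<^sup>2 < 1 / DIM('a)" if "b \<in> Basis" for b
      proof -
        have "\<bar>f e \<bullet> b\<bar> < 1 / sqrt DIM('a)"
          using neg that by (auto simp: self_adj[of e] inner_commute[of e] not_le)
        then have "\<bar>f e \<bullet> b\<bar>\<^sup>2 < (1 / sqrt DIM('a))\<^sup>2"
          by (intro power_strict_mono) auto
        then show ?thesis by (simp add: power_divide)
      qed
      then have "(\<Sum>b\<in>Basis. (f e \<bullet> b)\<^sup>2) < (\<Sum>b\<in>(Basis :: 'a set). 1 / DIM('a))"
        by (intro sum_strict_mono) auto
      then show False using 1 by simp
    qed
  qed
qed

section \<open>Test functions\<close>

text \<open>The mean value theorem for the even function \<open>F\<close>: its derivative is a
  difference of gradients at two points at most \<open>2 * \<tau>\<close> apart, and the gradient is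
  Lipschitz because the Hessian is bounded on the compact ball. The constant does not depend on the
  direction.\<close>

lemma C2_on_second_difference:
  fixes \<phi> :: "'a::euclidean_space \<Rightarrow> real"
  assumes "C2_on (cball x0 r) \<phi>" "0 < r"
  obtains K where "\<And>\<xi> \<tau>. norm \<xi> = 1 \<Longrightarrow> 0 < \<tau> \<Longrightarrow> \<tau> < r \<Longrightarrow>
    \<bar>\<phi> (x0 + \<tau> *\<^sub>R \<xi>) + \<phi> (x0 - \<tau> *\<^sub>R \<xi>) - 2 * \<phi> x0\<bar> \<le> K * \<tau>\<^sup>2"
proof -
  obtain g :: "'a \<Rightarrow> 'a" and H :: "'a \<Rightarrow> 'a \<Rightarrow>\<^sub>L 'a"
    where g: "\<And>x. x \<in> cball x0 r \<Longrightarrow> (\<phi> has_derivative (\<lambda>h. g x \<bullet> h)) (at x within cball x0 r)"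
      and H: "\<And>x. x \<in> cball x0 r \<Longrightarrow> (g has_derivative blinfun_apply (H x)) (at x within cball x0 r)"
      and cH: "continuous_on (cball x0 r) H"
    using assms(1) unfolding C2_on_def by blast
  have "bounded (H ` cball x0 r)"
    using cH by (intro compact_imp_bounded compact_continuous_image) auto
  then obtain K where K: "\<And>x. x \<in> cball x0 r \<Longrightarrow> norm (H x) \<le> K"
    unfolding bounded_iff by blast
  have lip: "norm (g x - g y) \<le> K * norm (x - y)" if "x \<in> cball x0 r" "y \<in> cball x0 r" for x y
    using that K H by (intro differentiable_bound[where S = "cball x0 r"]) (auto simp flip: norm_blinfun.rep_eq)
  show ?thesis
  proof (rule that[of "2 * K"])
    fix \<xi> :: 'a and \<tau> :: real
    assume x: "norm \<xi> = 1" and t: "0 < \<tau>" "\<tau> < r"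
    define F where "F t = \<phi> (x0 + t *\<^sub>R \<xi>) + \<phi> (x0 - t *\<^sub>R \<xi>)" for t
    define F' where "F' t = g (x0 + t *\<^sub>R \<xi>) \<bullet> \<xi> - g (x0 - t *\<^sub>R \<xi>) \<bullet> \<xi>" for t
    have in_ball: "x0 + z *\<^sub>R \<xi> \<in> ball x0 r" "x0 - z *\<^sub>R \<xi> \<in> ball x0 r" if "\<bar>z\<bar> < r" for z
      using that x by (auto simp: dist_norm)
    \<comment> \<open>At interior points the derivative within the closed ball is the full
      derivative.\<close>
    have d: "(\<phi> has_derivative (\<lambda>h. g x \<bullet> h)) (at x)" if "x \<in> ball x0 r" for x
      using g[of x] that at_within_interior[of x "cball x0 r"] by auto
    have D: "(F has_real_derivative F' z) (at z)" if "0 \<le> z" "z \<le> \<tau>" for z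
    proof -
      have z: "\<bar>z\<bar> < r" using that t by simp
      have 1: "((\<lambda>t. x0 + t *\<^sub>R \<xi>) has_derivative (\<lambda>h. h *\<^sub>R \<xi>)) (at z)"
        "((\<lambda>t. x0 - t *\<^sub>R \<xi>) has_derivative (\<lambda>h. - (h *\<^sub>R \<xi>))) (at z)"
        by (auto intro!: derivative_eq_intros)
      have "(F has_derivative (\<lambda>h. g (x0 + z *\<^sub>R \<xi>) \<bullet> (h *\<^sub>R \<xi>) + g (x0 - z *\<^sub>R \<xi>) \<bullet> (- (h *\<^sub>R \<xi>)))) (at z)"
        unfolding F_def
        by (intro has_derivative_add has_derivative_compose[OF 1(1) d[OF in_ball(1)[OF z]]]
            has_derivative_compose[OF 1(2) d[OF in_ball(2)[OF z]]])
      then show ?thesis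
        unfolding has_field_derivative_def by (rule has_derivative_eq_rhs) (auto simp: F'_def algebra_simps)
    qed
    obtain z where z: "0 < z" "z < \<tau>" "F \<tau> - F 0 = (\<tau> - 0) * F' z"
      using MVT2[of 0 \<tau> F F'] D t by auto
    have "\<bar>F' z\<bar> = \<bar>(g (x0 + z *\<^sub>R \<xi>) - g (x0 - z *\<^sub>R \<xi>)) \<bullet> \<xi>\<bar>"
      by (simp add: F'_def inner_diff_left)
    also have "\<dots> \<le> norm (g (x0 + z *\<^sub>R \<xi>) - g (x0 - z *\<^sub>R \<xi>))"
      using Cauchy_Schwarz_ineq2[of _ \<xi>] x by simp
    also have "\<dots> \<le> K * norm ((x0 + z *\<^sub>R \<xi>) - (x0 - z *\<^sub>R \<xi>))"
      using in_ball[of z] z t by (intro lip) (auto simp: mem_ball mem_cball)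
    also have "(x0 + z *\<^sub>R \<xi>) - (x0 - z *\<^sub>R \<xi>) = (2 * z) *\<^sub>R \<xi>"
      by (simp add: scaleR_2 flip: scaleR_scaleR)
    also have "K * norm ((2 * z) *\<^sub>R \<xi>) = 2 * K * z" using x z by simp
    also have "\<dots> \<le> 2 * K * \<tau>"
      using order_trans[OF norm_ge_zero K[of x0]] z assms(2) by (intro mult_left_mono) auto
    finally have "\<bar>F' z\<bar> \<le> 2 * K * \<tau>" .
    then have "\<tau> * \<bar>F' z\<bar> \<le> \<tau> * (2 * K * \<tau>)" using t by (intro mult_left_mono) auto
    moreover have "\<bar>F \<tau> - F 0\<bar> = \<tau> * \<bar>F' z\<bar>" using z(3) t by (simp add: abs_mult)
    ultimately show "\<bar>\<phi> (x0 + \<tau> *\<^sub>R \<xi>) + \<phi> (x0 - \<tau> *\<^sub>R \<xi>) - 2 * \<phi> x0\<bar> \<le> 2 * K * \<tau>\<^sup>2"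
      by (simp add: F_def power2_eq_square algebra_simps)
  qed
qed

text \<open>The glued function lies below \<open>u\<close> and agrees with it at \<open>x0\<close>,
  so its second differences lie below those of \<open>u\<close> and hence below \<open>F\<close>.
  The infimum is at most the sum over the single basis \<open>B\<close>. Regularity is asked only of
  \<open>\<phi>\<close>; \<open>u\<close> itself enters through the majorants.\<close>

lemma op_minus_test_function_le:
  fixes u \<phi> :: "'a::euclidean_space \<Rightarrow> real" and F :: "'a \<Rightarrow> real \<Rightarrow> real"
  assumes s: "0 < s" "s < 1" and C: "0 < C s"
    and u: "continuous_on UNIV u" "\<And>x. \<bar>u x\<bar> \<le> M"
    and r: "0 < r" and phi: "C2_on (cball x0 r) \<phi>" "\<phi> x0 = u x0" "\<And>x. x \<in> ball x0 r \<Longrightarrow> \<phi> x \<le> u x"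
    and B: "B \<in> orthonormal_bases"
    and F: "\<And>\<xi>. \<xi> \<in> B \<Longrightarrow> kernel_integrable s (F \<xi>)"
      "\<And>\<xi> \<tau>. \<xi> \<in> B \<Longrightarrow> 0 < \<tau> \<Longrightarrow> u (x0 + \<tau> *\<^sub>R \<xi>) + u (x0 - \<tau> *\<^sub>R \<xi>) - 2 * u x0 \<le> F \<xi> \<tau>"
  shows "op_minus C s (\<lambda>x. if x \<in> ball x0 r then \<phi> x else u x) x0 \<le> C s * (\<Sum>\<xi>\<in>B. kernel_integral s (F \<xi>))"
proof -
  define \<psi> where "\<psi> = (\<lambda>x. if x \<in> ball x0 r then \<phi> x else u x)"
  define \<Delta> where "\<Delta> \<xi> \<tau> = \<psi> (x0 + \<tau> *\<^sub>R \<xi>) + \<psi> (x0 - \<tau> *\<^sub>R \<xi>) - 2 * \<psi> x0" for \<xi> \<tau>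
  have dir: "dir_op C s \<xi> \<psi> x0 = C s * kernel_integral s (\<Delta> \<xi>)" for \<xi>
    by (simp add: dir_op_def kernel_integral_def \<Delta>_def)
  obtain K where K: "\<And>\<xi> \<tau>. norm \<xi> = 1 \<Longrightarrow> 0 < \<tau> \<Longrightarrow> \<tau> < r \<Longrightarrow>
      \<bar>\<phi> (x0 + \<tau> *\<^sub>R \<xi>) + \<phi> (x0 - \<tau> *\<^sub>R \<xi>) - 2 * \<phi> x0\<bar> \<le> K * \<tau>\<^sup>2"
    using C2_on_second_difference[OF phi(1) r] by blast
  obtain D where D: "\<And>f. f \<in> borel_measurable borel \<Longrightarrow>
      (\<And>\<tau>. 0 < \<tau> \<Longrightarrow> \<tau> < r \<Longrightarrow> \<bar>f \<tau>\<bar> \<le> K * \<tau>\<^sup>2) \<Longrightarrow> (\<And>\<tau>. r \<le> \<tau> \<Longrightarrow> \<bar>f \<tau>\<bar> \<le> (4 * M) * \<tau> powr 0) \<Longrightarrow>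
      kernel_integrable s f \<and> - D \<le> kernel_integral s f"
    using kernel_integrable_dominated[of s r 0 K "4 * M"] s r by auto
  obtain g where "\<And>x. x \<in> cball x0 r \<Longrightarrow> (\<phi> has_derivative (\<lambda>h. g x \<bullet> h)) (at x within cball x0 r)"
    using phi(1) unfolding C2_on_def by blast
  then have cphi: "continuous_on (cball x0 r) \<phi>"
    by (rule has_derivative_continuous_on)
  have psi_x0: "\<psi> x0 = u x0" using phi r by (simp add: \<psi>_def)
  have psi_le: "\<psi> x \<le> u x" for x using phi(3) by (simp add: \<psi>_def)
  have meas: "(\<lambda>\<tau>. \<psi> (x0 + \<tau> *\<^sub>R \<xi>)) \<in> borel_measurable borel" if "norm \<xi> = 1" for \<xi>
  proof -
    \<comment> \<open>Along a unit direction the ball is the interval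
      \<open>\<bar>\<tau>\<bar> < r\<close>, so the glued function is piecewise continuous and hence
      Borel.\<close>
    have "(\<lambda>\<tau>. \<psi> (x0 + \<tau> *\<^sub>R \<xi>)) = (\<lambda>\<tau>. if \<tau> \<in> {- r<..<r} then \<phi> (x0 + \<tau> *\<^sub>R \<xi>) else u (x0 + \<tau> *\<^sub>R \<xi>))"
      using that by (auto simp: \<psi>_def dist_norm fun_eq_iff)
    also have "\<dots> \<in> borel_measurable borel"
    proof (rule borel_measurable_continuous_on_if)
      show "continuous_on {- r<..<r} (\<lambda>\<tau>. \<phi> (x0 + \<tau> *\<^sub>R \<xi>))"
        using that by (intro continuous_on_compose2[OF cphi] continuous_intros) (auto simp: dist_norm)
      show "continuous_on (- {- r<..<r}) (\<lambda>\<tau>. u (x0 + \<tau> *\<^sub>R \<xi>))"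
        by (intro continuous_on_compose2[OF u(1)] continuous_intros) auto
    qed auto
    finally show ?thesis .
  qed
  have \<Delta>: "kernel_integrable s (\<Delta> \<xi>) \<and> - D \<le> kernel_integral s (\<Delta> \<xi>)" if x: "norm \<xi> = 1" for \<xi>
  proof (rule D)
    show "\<Delta> \<xi> \<in> borel_measurable borel"
      using meas[OF x] meas[of "- \<xi>"] x unfolding \<Delta>_def by simp
    fix \<tau> :: real
    show "\<bar>\<Delta> \<xi> \<tau>\<bar> \<le> K * \<tau>\<^sup>2" if "0 < \<tau>" "\<tau> < r"
      using K[OF x that] that x r by (simp add: \<Delta>_def \<psi>_def dist_norm)
    show "\<bar>\<Delta> \<xi> \<tau>\<bar> \<le> (4 * M) * \<tau> powr 0" if "r \<le> \<tau>"
      using u(2)[of "x0 + \<tau> *\<^sub>R \<xi>"] u(2)[of "x0 - \<tau> *\<^sub>R \<xi>"] u(2)[of x0] that x r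
      by (simp add: \<Delta>_def psi_x0) (simp add: \<psi>_def dist_norm)
  qed
  \<comment> \<open>A real infimum is a lower bound only for sets bounded below; the uniform
    \<open>D\<close> and the bound on the cardinality of a basis provide this.\<close>
  have "bdd_below ((\<lambda>B. \<Sum>\<xi>\<in>B. dir_op C s \<xi> \<psi> x0) ` orthonormal_bases)"
  proof (rule bdd_belowI2)
    fix B :: "'a set" assume B: "B \<in> orthonormal_bases"
    have "- (DIM('a) * \<bar>C s * D\<bar>) \<le> - (card B * \<bar>C s * D\<bar>)"
      using orthonormal_bases_finite[OF B] by (simp add: mult_right_mono)
    also have "\<dots> = (\<Sum>\<xi>\<in>B. - \<bar>C s * D\<bar>)" by simp
    also have "\<dots> \<le> (\<Sum>\<xi>\<in>B. dir_op C s \<xi> \<psi> x0)"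
    proof (rule sum_mono)
      fix \<xi> assume "\<xi> \<in> B"
      then have "- D \<le> kernel_integral s (\<Delta> \<xi>)" using \<Delta> B by (auto simp: orthonormal_bases_def)
      then have "C s * (- D) \<le> C s * kernel_integral s (\<Delta> \<xi>)" using C by (intro mult_left_mono) auto
      then show "- \<bar>C s * D\<bar> \<le> dir_op C s \<xi> \<psi> x0" unfolding dir by simp
    qed
    finally show "- (DIM('a) * \<bar>C s * D\<bar>) \<le> (\<Sum>\<xi>\<in>B. dir_op C s \<xi> \<psi> x0)" .
  qed
  then have "op_minus C s \<psi> x0 \<le> (\<Sum>\<xi>\<in>B. dir_op C s \<xi> \<psi> x0)"
    unfolding op_minus_def using B by (rule cINF_lower)
  also have "\<dots> \<le> (\<Sum>\<xi>\<in>B. C s * kernel_integral s (F \<xi>))"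
  proof (rule sum_mono)
    fix \<xi> assume x: "\<xi> \<in> B"
    have "\<Delta> \<xi> \<tau> \<le> F \<xi> \<tau>" if "0 < \<tau>" for \<tau>
      using F(2)[OF x that] psi_le[of "x0 + \<tau> *\<^sub>R \<xi>"] psi_le[of "x0 - \<tau> *\<^sub>R \<xi>"] by (simp add: \<Delta>_def psi_x0)
    then have "kernel_integral s (\<Delta> \<xi>) \<le> kernel_integral s (F \<xi>)"
      using \<Delta> F(1)[OF x] x B by (intro kernel_integral_mono) (auto simp: orthonormal_bases_def)
    then show "dir_op C s \<xi> \<psi> x0 \<le> C s * kernel_integral s (F \<xi>)"
      unfolding dir using C by (intro mult_left_mono) auto
  qed
  also have "\<dots> = C s * (\<Sum>\<xi>\<in>B. kernel_integral s (F \<xi>))" by (simp add: sum_distrib_left)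
  finally show ?thesis unfolding \<psi>_def .
qed

section \<open>The barrier\<close>

definition up :: "(real ^ 'm) \<times> real"
  where "up = (0, 1)"

text \<open>On the half-space neither \<open>max\<close> has any effect, because
  \<open>norm (x + up) > 1\<close> there. Outside, \<open>max 1\<close> removes the singularity at
  \<open>- up\<close>, and \<open>max 0\<close> makes the second branch zero, as
  \<open>0 powr a = 0\<close>. The result is continuous on the whole space when
  \<open>a > 0\<close>.\<close>

definition barrier :: "real \<Rightarrow> real \<Rightarrow> (real ^ 'm) \<times> real \<Rightarrow> real"
  where "barrier \<gamma> a x = min (max 1 (norm (x + up)) powr (- \<gamma>)) (max 0 (snd x) powr a)"

lemma norm_up [simp]: "norm up = 1" and inner_up [simp]: "x \<bullet> up = snd x" and snd_up [simp]: "snd up = 1"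
  by (auto simp: up_def norm_Pair inner_prod_def)

lemma norm_add_up_ge: "snd x + 1 \<le> norm (x + up)"
proof -
  have "snd (x + up) \<le> norm (x + up)"
    using Cauchy_Schwarz_ineq2[of "x + up" up] by simp
  then show ?thesis by simp
qed

lemma barrier_bounds:
  fixes x :: "(real ^ 'm) \<times> real"
  assumes "0 \<le> \<gamma>"
  shows "0 \<le> barrier \<gamma> a x" "barrier \<gamma> a x \<le> 1" "snd x \<le> 0 \<Longrightarrow> barrier \<gamma> a x = 0"
    "0 < snd x \<Longrightarrow> 0 < barrier \<gamma> a x" "barrier \<gamma> a x \<le> max 0 (snd x) powr a"
    "0 < norm (x + up) \<Longrightarrow> barrier \<gamma> a x \<le> norm (x + up) powr (- \<gamma>)"
    "barrier \<gamma> a x \<le> max 1 (norm (x + up)) powr (- \<gamma>)"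
proof -
  have 1: "max 1 (norm (x + up)) powr (- \<gamma>) \<le> 1"
    using powr_mono2'[of "- \<gamma>" 1 "max 1 (norm (x + up))"] assms by simp
  show "barrier \<gamma> a x \<le> 1" using 1 by (simp add: barrier_def min_le_iff_disj)
  show "barrier \<gamma> a x \<le> norm (x + up) powr (- \<gamma>)" if "0 < norm (x + up)"
    using powr_mono2'[of "- \<gamma>" "norm (x + up)" "max 1 (norm (x + up))"] assms that
    by (simp add: barrier_def min_le_iff_disj)
qed (auto simp: barrier_def max_def)

lemma continuous_on_barrier:
  assumes "0 < a"
  shows "continuous_on UNIV (barrier \<gamma> a)"
  unfolding barrier_def using assms
  by (intro continuous_on_min continuous_on_powr' continuous_intros) auto

lemma barrier_tendsto_0:
  assumes "0 < \<gamma>"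
  shows "(barrier \<gamma> a \<longlongrightarrow> 0) at_infinity"
proof (rule tendsto_sandwich[OF _ _ tendsto_const])
  have "LIM x at_infinity. norm (x :: (real ^ 'm) \<times> real) - 1 :> at_top"
    using filterlim_tendsto_add_at_top[OF tendsto_const[of "- 1"] filterlim_norm_at_top] by simp
  then have "LIM x at_infinity. max 1 (norm ((x :: (real ^ 'm) \<times> real) + up)) :> at_top"
  proof (rule filterlim_at_top_mono)
    show "\<forall>\<^sub>F x in at_infinity. norm (x :: (real ^ 'm) \<times> real) - 1 \<le> max 1 (norm (x + up))"
    proof (intro always_eventually allI)
      fix x :: "(real ^ 'm) \<times> real"
      show "norm x - 1 \<le> max 1 (norm (x + up))"
        using norm_triangle_ineq4[of "x + up" up] by simp
    qed
  qed
  then show "((\<lambda>x. max 1 (norm ((x :: (real ^ 'm) \<times> real) + up)) powr (- \<gamma>)) \<longlongrightarrow> 0) at_infinity"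
    using assms by (intro tendsto_neg_powr) auto
qed (use assms in \<open>auto intro!: always_eventually barrier_bounds\<close>)

text \<open>Rescaled by \<open>R\<close>, every direction of the equiangular basis contributes the
  integral \<open>c_fun N s \<gamma>\<close> of the full power. Along one steep direction an end of
  the segment has left the half-space once \<open>\<tau> \<ge> sqrt N * R\<close>, and the term that
  disappears there is at least \<open>(2 * \<tau>) powr (- \<gamma>)\<close>, which integrates to
  \<open>loss\<close>.\<close>

lemma barrier_interior:
  fixes x0 :: "(real ^ 'm) \<times> real"
  defines "N \<equiv> DIM((real ^ 'm) \<times> real)" and "R \<equiv> norm (x0 + up)"
  assumes s: "0 < s" "s < 1" and \<gamma>: "0 < \<gamma>" and x0: "0 < snd x0"
    and eq: "barrier \<gamma> a x0 = R powr (- \<gamma>)"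
  obtains B F where "B \<in> orthonormal_bases" "\<And>\<xi>. \<xi> \<in> B \<Longrightarrow> kernel_integrable s (F \<xi>)"
    "\<And>\<xi> \<tau>. \<xi> \<in> B \<Longrightarrow> 0 < \<tau> \<Longrightarrow>
      barrier \<gamma> a (x0 + \<tau> *\<^sub>R \<xi>) + barrier \<gamma> a (x0 - \<tau> *\<^sub>R \<xi>) - 2 * barrier \<gamma> a x0 \<le> F \<xi> \<tau>"
    "(\<Sum>\<xi>\<in>B. kernel_integral s (F \<xi>)) = R powr (- \<gamma> - 2 * s) * (real N * c_fun N s \<gamma> - loss (sqrt N) s \<gamma>)"
proof -
  define b where "b = 1 / sqrt N"
  have N: "2 \<le> N" by (simp add: N_def Suc_le_eq)
  have b: "0 < b" "b\<^sup>2 \<le> 1 / 2" "(- b)\<^sup>2 \<le> 1 / 2" using N by (auto simp: b_def power_divide field_simps)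
  have rN: "1 \<le> sqrt N" "0 < sqrt N" using N by auto
  have R: "snd x0 + 1 \<le> R" unfolding R_def by (rule norm_add_up_ge)
  then have R0: "0 < R" using x0 by simp
  have "norm ((1 / R) *\<^sub>R (x0 + up)) = 1" using R0 by (simp add: R_def)
  then obtain B where B: "B \<in> orthonormal_bases" "card B = N"
    and Bb: "\<And>\<xi>. \<xi> \<in> B \<Longrightarrow> \<xi> \<bullet> ((1 / R) *\<^sub>R (x0 + up)) = b"
    and Be: "\<And>e :: (real ^ 'm) \<times> real. norm e = 1 \<Longrightarrow> \<exists>\<xi>\<in>B. b \<le> \<bar>\<xi> \<bullet> e\<bar>"
    unfolding N_def b_def using equiangular_basis by metis
  \<comment> \<open>The steep direction: its vertical component is at least
    \<open>1 / sqrt N\<close> in modulus.\<close>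
  obtain \<xi>1 where \<xi>1: "\<xi>1 \<in> B" "b \<le> \<bar>snd \<xi>1\<bar>" using Be[OF norm_up] by auto
  define G where "G = second_diff b \<gamma>"
  \<comment> \<open>For \<open>t \<ge> sqrt N \<ge> 1\<close>, both ends are at distance at most
    \<open>R * (1 + t) \<le> R * (2 * t)\<close> from \<open>- up\<close>, whence the factor
    \<open>2 powr (- \<gamma>)\<close>.\<close>
  define L where "L = (\<lambda>t. 2 powr (- \<gamma>) * (if t < sqrt N then 0 else t powr (- \<gamma>)))"
  define H where "H \<xi> t = G t - (if \<xi> = \<xi>1 then 1 else 0) * L t" for \<xi> t
  define F where "F \<xi> \<tau> = R powr (- \<gamma>) * H \<xi> (\<tau> / R)" for \<xi> \<tau>
  have G: "kernel_integrable s G" "kernel_integral s G = c_fun N s \<gamma>"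
    using kernel_integrable_second_diff[OF b(2) s] \<gamma> by (auto simp: G_def c_fun_eq b_def)
  have L: "kernel_integrable s L" "kernel_integral s L = loss (sqrt N) s \<gamma>"
    using kernel_tail[OF s(1) rN(2), of "- \<gamma>"] s \<gamma>
    unfolding L_def loss_def by (auto intro!: kernel_integrable_cmult simp: kernel_integral_cmult)
  have H: "kernel_integrable s (H \<xi>)"
    "kernel_integral s (H \<xi>) = c_fun N s \<gamma> - (if \<xi> = \<xi>1 then 1 else 0) * loss (sqrt N) s \<gamma>" for \<xi>
    unfolding H_def using G L
    by (simp_all only: kernel_integrable_diff kernel_integral_diff kernel_integrable_cmult kernel_integral_cmult)
  show ?thesis
  proof (rule that[OF B(1)])
    show "kernel_integrable s (F \<xi>)" for \<xi>
      unfolding F_def by (intro kernel_integrable_cmult kernel_scale H R0)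
    have "kernel_integral s (F \<xi>) = R powr (- \<gamma> - 2 * s) * (c_fun N s \<gamma> - (if \<xi> = \<xi>1 then 1 else 0) * loss (sqrt N) s \<gamma>)" for \<xi>
      unfolding F_def kernel_integral_cmult kernel_scale(2)[OF R0] H(2)
      by (simp add: powr_diff powr_minus field_simps)
    then have "(\<Sum>\<xi>\<in>B. kernel_integral s (F \<xi>)) =
        R powr (- \<gamma> - 2 * s) * (\<Sum>\<xi>\<in>B. c_fun N s \<gamma> - (if \<xi> = \<xi>1 then 1 else 0) * loss (sqrt N) s \<gamma>)"
      by (simp add: sum_distrib_left)
    also have "(\<Sum>\<xi>\<in>B. c_fun N s \<gamma> - (if \<xi> = \<xi>1 then 1 else 0) * loss (sqrt N) s \<gamma>) =
        real N * c_fun N s \<gamma> - loss (sqrt N) s \<gamma>"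
      using \<xi>1(1) B(2) orthonormal_bases_finite(1)[OF B(1)]
      by (simp add: sum_subtractf sum.delta flip: sum_distrib_right)
    finally show "(\<Sum>\<xi>\<in>B. kernel_integral s (F \<xi>)) = R powr (- \<gamma> - 2 * s) * (real N * c_fun N s \<gamma> - loss (sqrt N) s \<gamma>)" .
    fix \<xi> and \<tau> :: real
    assume \<xi>: "\<xi> \<in> B" and \<tau>: "0 < \<tau>"
    define t where "t = \<tau> / R"
    have t: "0 < t" "\<tau> = R * t" using \<tau> R0 by (auto simp: t_def)
    have n\<xi>: "\<xi> \<bullet> \<xi> = 1" using \<xi> B by (auto simp: orthonormal_bases_def norm_eq_1)
    have in\<xi>: "(x0 + up) \<bullet> \<xi> = R * b" using Bb[OF \<xi>] R0 unfolding inner_scaleR_right by (simp add: inner_commute field_simps)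
    \<comment> \<open>The sign \<open>\<sigma>\<close> treats the two ends of the segment
      together.\<close>
    have key: "0 < norm (x0 + (\<sigma> * \<tau>) *\<^sub>R \<xi> + up)"
      "norm (x0 + (\<sigma> * \<tau>) *\<^sub>R \<xi> + up) powr (- \<gamma>) = R powr (- \<gamma>) * sq_dist (\<sigma> * b) t powr (- \<gamma> / 2)"
      "norm (x0 + (\<sigma> * \<tau>) *\<^sub>R \<xi> + up) \<le> R * (1 + t)"
      if \<sigma>: "\<sigma> = 1 \<or> \<sigma> = - 1" for \<sigma>
    proof -
      define n where "n = norm (x0 + (\<sigma> * \<tau>) *\<^sub>R \<xi> + up)"
      have \<sigma>2: "\<sigma> * \<sigma> = 1" using \<sigma> by auto
      have "n\<^sup>2 = ((x0 + up) + (\<sigma> * \<tau>) *\<^sub>R \<xi>) \<bullet> ((x0 + up) + (\<sigma> * \<tau>) *\<^sub>R \<xi>)"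
        by (simp add: n_def power2_norm_eq_inner algebra_simps)
      also have "\<dots> = (x0 + up) \<bullet> (x0 + up) + 2 * (\<sigma> * \<tau>) * ((x0 + up) \<bullet> \<xi>) + (\<sigma> * \<sigma>) * \<tau>\<^sup>2 * (\<xi> \<bullet> \<xi>)"
        by (simp add: inner_add inner_commute power2_eq_square algebra_simps)
      also have "(x0 + up) \<bullet> (x0 + up) = R\<^sup>2" by (simp only: R_def power2_norm_eq_inner)
      also have "R\<^sup>2 + 2 * (\<sigma> * \<tau>) * ((x0 + up) \<bullet> \<xi>) + (\<sigma> * \<sigma>) * \<tau>\<^sup>2 * (\<xi> \<bullet> \<xi>) = R\<^sup>2 * sq_dist (\<sigma> * b) t"
        unfolding in\<xi> n\<xi> \<sigma>2 by (simp add: t(2) sq_dist_def power2_eq_square algebra_simps)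
      finally have n2: "n\<^sup>2 = R\<^sup>2 * sq_dist (\<sigma> * b) t" .
      have sq: "0 < sq_dist (\<sigma> * b) t"
        using sq_dist_ge[of "\<sigma> * b" t] \<sigma> b by auto
      have "0 < n\<^sup>2" unfolding n2 using R0 sq by simp
      then show n0: "0 < n" by (simp add: n_def)
      have "n powr (- \<gamma>) = (n powr 2) powr (- \<gamma> / 2)" by (simp add: powr_powr del: powr_numeral)
      also have "n powr 2 = R powr 2 * sq_dist (\<sigma> * b) t" using n2 n0 R0 by simp
      also have "(R powr 2 * sq_dist (\<sigma> * b) t) powr (- \<gamma> / 2) = R powr (- \<gamma>) * sq_dist (\<sigma> * b) t powr (- \<gamma> / 2)"
        using sq by (simp add: powr_mult powr_powr del: powr_numeral)
      finally show "n powr (- \<gamma>) = R powr (- \<gamma>) * sq_dist (\<sigma> * b) t powr (- \<gamma> / 2)" .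
      have "n \<le> norm (x0 + up) + norm ((\<sigma> * \<tau>) *\<^sub>R \<xi>)"
        using norm_triangle_ineq[of "x0 + up" "(\<sigma> * \<tau>) *\<^sub>R \<xi>"] by (simp add: n_def ac_simps)
      also have "\<dots> = R + \<tau>"
        using n\<xi> \<sigma> \<tau> by (auto simp: R_def norm_eq_1)
      also have "\<dots> = R * (1 + t)"
        by (simp add: t(2) algebra_simps)
      finally show "n \<le> R * (1 + t)" .
    qed
    define P where "P \<sigma> = R powr (- \<gamma>) * sq_dist (\<sigma> * b) t powr (- \<gamma> / 2)" for \<sigma>
    have le: "barrier \<gamma> a (x0 + (\<sigma> * \<tau>) *\<^sub>R \<xi>) \<le> P \<sigma>" if "\<sigma> = 1 \<or> \<sigma> = - 1" for \<sigma>
      using barrier_bounds(6)[OF less_imp_le[OF \<gamma>] key(1)[OF that]] key(2)[OF that] by (simp add: P_def)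
    have P0: "0 \<le> P \<sigma>" for \<sigma> by (simp add: P_def)
    have "barrier \<gamma> a (x0 + \<tau> *\<^sub>R \<xi>) + barrier \<gamma> a (x0 - \<tau> *\<^sub>R \<xi>) \<le>
        P 1 + P (- 1) - (if \<xi> = \<xi>1 then 1 else 0) * (R powr (- \<gamma>) * L t)"
    proof (cases "\<xi> = \<xi>1 \<and> sqrt N \<le> t")
      case True
      have Lt: "R powr (- \<gamma>) * L t = (R * (2 * t)) powr (- \<gamma>)"
        using True t R0 by (simp add: L_def powr_mult)
      have big: "R powr (- \<gamma>) * L t \<le> P \<sigma>" if \<sigma>: "\<sigma> = 1 \<or> \<sigma> = - 1" for \<sigma>
      proof -
        have "1 \<le> t" using True rN(1) by linarith
        then have "R * (1 + t) \<le> R * (2 * t)" using R0 by (intro mult_left_mono) auto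
        then have "norm (x0 + (\<sigma> * \<tau>) *\<^sub>R \<xi> + up) \<le> R * (2 * t)" using key(3)[OF \<sigma>] by linarith
        then have "(R * (2 * t)) powr (- \<gamma>) \<le> norm (x0 + (\<sigma> * \<tau>) *\<^sub>R \<xi> + up) powr (- \<gamma>)"
          using key(1)[OF \<sigma>] \<gamma> by (intro powr_mono2') auto
        then show ?thesis unfolding Lt P_def key(2)[OF \<sigma>] .
      qed
      \<comment> \<open>The vertical displacement is at least \<open>R\<close>, which exceeds the
        height of \<open>x0\<close>; the sign of \<open>snd \<xi>1\<close> decides which end has
        left the half-space.\<close>
      have "1 = sqrt N * b" using rN by (simp add: b_def)
      also have "\<dots> \<le> t * \<bar>snd \<xi>1\<bar>" using True \<xi>1 b rN(2) t(1) by (intro mult_mono) auto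
      finally have "R * 1 \<le> R * (t * \<bar>snd \<xi>1\<bar>)" using R0 by (intro mult_left_mono) auto
      then have "snd x0 \<le> \<tau> * \<bar>snd \<xi>1\<bar>" using R t by (simp add: mult.assoc)
      then consider "snd (x0 + (1 * \<tau>) *\<^sub>R \<xi>) \<le> 0" | "snd (x0 + (- 1 * \<tau>) *\<^sub>R \<xi>) \<le> 0"
        using True by (cases "0 \<le> snd \<xi>1") auto
      then have "barrier \<gamma> a (x0 + (1 * \<tau>) *\<^sub>R \<xi>) + barrier \<gamma> a (x0 + (- 1 * \<tau>) *\<^sub>R \<xi>) + R powr (- \<gamma>) * L t \<le> P 1 + P (- 1)"
      proof cases
        case 1
        then have "barrier \<gamma> a (x0 + (1 * \<tau>) *\<^sub>R \<xi>) = 0" using barrier_bounds(3) \<gamma> by (metis less_imp_le)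
        then show ?thesis using le[of "- 1"] big[of 1] by linarith
      next
        case 2
        then have "barrier \<gamma> a (x0 + (- 1 * \<tau>) *\<^sub>R \<xi>) = 0" using barrier_bounds(3) \<gamma> by (metis less_imp_le)
        then show ?thesis using le[of 1] big[of "- 1"] by linarith
      qed
      then show ?thesis using True by simp
    next
      case False
      then have "\<xi> = \<xi>1 \<Longrightarrow> L t = 0" by (auto simp: L_def)
      then show ?thesis using le[of 1] le[of "- 1"] by auto
    qed
    moreover have "F \<xi> \<tau> = P 1 + P (- 1) - (if \<xi> = \<xi>1 then 1 else 0) * (R powr (- \<gamma>) * L t) - 2 * R powr (- \<gamma>)"
      unfolding F_def H_def t_def[symmetric] G_def second_diff_def P_def by (simp add: algebra_simps)
    ultimately show "barrier \<gamma> a (x0 + \<tau> *\<^sub>R \<xi>) + barrier \<gamma> a (x0 - \<tau> *\<^sub>R \<xi>) - 2 * barrier \<gamma> a x0 \<le> F \<xi> \<tau>"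
      unfolding eq by linarith
  qed
qed

text \<open>Horizontal basis vectors do not change the height, so only \<open>up\<close>
  contributes. At scale \<open>h\<close>, concavity of the power makes the second difference
  nonpositive for \<open>t < 1\<close>; for \<open>t \<ge> 1\<close> one end has value zero and the
  other is controlled by \<open>1 + t \<le> 2 * t\<close>.\<close>

lemma barrier_boundary:
  fixes x0 :: "(real ^ 'm) \<times> real"
  assumes s: "0 < s" "s < 1" and \<gamma>: "0 < \<gamma>" and a: "0 < a" "a \<le> 1" "a < 2 * s" and x0: "0 < snd x0"
    and eq: "barrier \<gamma> a x0 = snd x0 powr a"
  obtains F where "\<And>\<xi>. \<xi> \<in> Basis \<Longrightarrow> kernel_integrable s (F \<xi>)"
    "\<And>\<xi> \<tau>. \<xi> \<in> Basis \<Longrightarrow> 0 < \<tau> \<Longrightarrow>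
      barrier \<gamma> a (x0 + \<tau> *\<^sub>R \<xi>) + barrier \<gamma> a (x0 - \<tau> *\<^sub>R \<xi>) - 2 * barrier \<gamma> a x0 \<le> F \<xi> \<tau>"
    "(\<Sum>\<xi>\<in>Basis. kernel_integral s (F \<xi>)) = snd x0 powr (a - 2 * s) * (2 powr a / (2 * s - a) - 1 / s)"
proof -
  define h where "h = snd x0"
  have h: "0 < h" using x0 by (simp add: h_def)
  \<comment> \<open>Zero for \<open>t < 1\<close> and \<open>(2 * t) powr a - 2\<close> from
    \<open>t = 1\<close> on, split into two tails with explicit integrals.\<close>
  define H where "H = (\<lambda>t::real. 2 powr a * (if t < 1 then 0 else t powr a) + (- 2) * (if t < 1 then 0 else t powr 0))"
  define F where "F \<xi> \<tau> = (if \<xi> = (up :: (real ^ 'm) \<times> real) then h powr a else 0) * H (\<tau> / h)" for \<xi> \<tau>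
  note tail = kernel_tail[OF s(1) zero_less_one a(3)] kernel_tail[OF s(1) zero_less_one, of 0]
  have Hi: "kernel_integrable s H"
    unfolding H_def using s a by (intro kernel_integrable_add kernel_integrable_cmult tail) auto
  have "kernel_integral s H = 2 powr a * (1 powr (a - 2 * s) / (2 * s - a)) + (- 2) * (1 powr (0 - 2 * s) / (2 * s - 0))"
    unfolding H_def using s by (simp only: kernel_integral_lincomb tail)
  then have H: "kernel_integral s H = 2 powr a / (2 * s - a) - 1 / s" by simp
  have up: "up \<in> (Basis :: ((real ^ 'm) \<times> real) set)" by (simp add: up_def Basis_prod_def)
  show ?thesis
  proof (rule that)
    show "kernel_integrable s (F \<xi>)" for \<xi>
      unfolding F_def by (intro kernel_integrable_cmult kernel_scale Hi h)
    have "kernel_integral s (F \<xi>) = (if \<xi> = up then h powr (a - 2 * s) * kernel_integral s H else 0)" for \<xi>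
      unfolding F_def kernel_integral_cmult kernel_scale(2)[OF h]
      by (simp add: powr_diff powr_minus field_simps)
    then show "(\<Sum>\<xi>\<in>Basis. kernel_integral s (F \<xi>)) = snd x0 powr (a - 2 * s) * (2 powr a / (2 * s - a) - 1 / s)"
      using up by (simp add: sum.delta H h_def)
    fix \<xi> :: "(real ^ 'm) \<times> real" and \<tau> :: real
    assume \<xi>: "\<xi> \<in> Basis" and \<tau>: "0 < \<tau>"
    have le: "barrier \<gamma> a (x0 + \<tau> *\<^sub>R \<xi>) + barrier \<gamma> a (x0 - \<tau> *\<^sub>R \<xi>) \<le>
        max 0 (h + \<tau> * snd \<xi>) powr a + max 0 (h - \<tau> * snd \<xi>) powr a"
      using barrier_bounds(5)[of \<gamma> a "x0 + \<tau> *\<^sub>R \<xi>"] barrier_bounds(5)[of \<gamma> a "x0 - \<tau> *\<^sub>R \<xi>"] \<gamma> by (simp add: h_def)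
    show "barrier \<gamma> a (x0 + \<tau> *\<^sub>R \<xi>) + barrier \<gamma> a (x0 - \<tau> *\<^sub>R \<xi>) - 2 * barrier \<gamma> a x0 \<le> F \<xi> \<tau>"
    proof (cases "\<xi> = up")
      case False
      then have "snd \<xi> = 0" using \<xi> by (auto simp: Basis_prod_def up_def)
      then show ?thesis using le h False by (simp add: F_def eq h_def)
    next
      case True
      define t where "t = \<tau> / h"
      have t: "0 < t" "\<tau> = h * t" using \<tau> h by (auto simp: t_def)
      have "max 0 (h + \<tau>) powr a + max 0 (h - \<tau>) powr a - 2 * h powr a \<le> h powr a * H t"
      proof (cases "t < 1")
        case t1: True
        have "0 \<le> h * (1 - t)" using h t1 by (intro mult_nonneg_nonneg) auto
        then have max_eq: "max 0 (h + \<tau>) = h * (1 + t)" "max 0 (h - \<tau>) = h * (1 - t)"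
          using h t by (auto simp: algebra_simps)
        have "max 0 (h + \<tau>) powr a + max 0 (h - \<tau>) powr a = h powr a * ((1 + t) powr a + (1 - t) powr a)"
          unfolding max_eq powr_mult by (rule distrib_left[symmetric])
        also have "\<dots> \<le> h powr a * 2"
          using powr_Bernoulli[of "1 + t" a] powr_Bernoulli[of "1 - t" a] t t1 a by (intro mult_left_mono) auto
        finally show ?thesis using t1 by (simp add: H_def)
      next
        case t1: False
        have "h * 1 \<le> h * t" using t1 h by (intro mult_left_mono) auto
        then have "h \<le> \<tau>" using t by simp
        then have max_eq: "max 0 (h + \<tau>) = h + \<tau>" "max 0 (h - \<tau>) = 0" using h by auto
        have "(h + \<tau>) powr a \<le> (h * (2 * t)) powr a"
          using \<open>h \<le> \<tau>\<close> h a t by (intro powr_mono2) auto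
        also have "\<dots> = h powr a * (2 powr a * t powr a)" by (simp only: powr_mult)
        finally have "(h + \<tau>) powr a + 0 powr a - 2 * h powr a \<le> h powr a * (2 powr a * t powr a - 2)"
          by (simp add: right_diff_distrib)
        also have "2 powr a * t powr a - 2 = H t" using t1 t(1) by (simp add: H_def)
        finally show ?thesis unfolding max_eq .
      qed
      then show ?thesis using le True by (simp add: F_def eq t_def h_def)
    qed
  qed
qed

section \<open>Choice of the parameters and verification of the supersolution inequality\<close>

theorem theorem1p5:
  fixes s :: real and C :: "real \<Rightarrow> real"
  assumes "0 < s" and "s < 1" and "normalizing C"
  shows "\<exists>\<gamma>p > gamma_tilde DIM((real ^ 'm) \<times> real) s.
    \<forall>p > 1 + 2 * s / \<gamma>p.
      \<exists>u :: (real ^ 'm) \<times> real \<Rightarrow> real.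
        viscosity_supersolution s (op_minus C s) p u \<and>
        (\<forall>x. u x \<ge> 0) \<and>
        continuous_on UNIV u \<and> bounded (range u) \<and>
        (\<forall>x. x \<notin> half_space \<longrightarrow> u x = 0) \<and>
        (\<forall>x\<in>half_space. u x > 0) \<and>
        (u \<longlongrightarrow> 0) at_infinity"
proof -
  define N where "N = DIM((real ^ 'm) \<times> real)"
  \<comment> \<open>Then \<open>2 * s - a = 3 * s / 2\<close>, while
    \<open>2 powr a \<le> 1 + a < 3 / 2\<close>; this makes \<open>k2\<close> positive.\<close>
  define a where "a = s / 2"
  define k2 where "k2 = 1 / s - 2 powr a / (2 * s - a)"
  have Cs: "0 < C s" using assms by (simp add: normalizing_def)
  have N: "2 \<le> N" by (simp add: N_def Suc_le_eq)
  have a: "0 < a" "a \<le> 1" "a < 2 * s" using assms by (auto simp: a_def)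
  have "2 powr a < 3 / 2" using powr_Bernoulli[of 2 a] a assms by (simp add: a_def)
  then have "2 powr a / (2 * s - a) < (3 / 2) / (2 * s - a)"
    using a by (intro divide_strict_right_mono) auto
  also have "\<dots> = 1 / s" using assms by (simp add: a_def field_simps)
  finally have k2: "0 < k2" by (simp add: k2_def)
  have "0 < sqrt (real N)" using N by simp
  \<comment> \<open>This \<open>\<gamma>\<close>, fixed before \<open>p\<close>, is the witness. The
    radius \<open>sqrt N\<close> is the rescaled distance after which the steep direction has left
    the half-space.\<close>
  then obtain \<gamma> where \<gamma>t: "gamma_tilde N s < \<gamma>" and "real N * c_fun N s \<gamma> < loss (sqrt N) s \<gamma>"
    using c_fun_less_loss[OF N assms(1,2)] by blast
  then have \<gamma>: "0 < \<gamma>" and k1: "0 < loss (sqrt N) s \<gamma> - real N * c_fun N s \<gamma>"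
    using c_fun_gamma_tilde(2)[OF N assms(1,2)] by auto
  define k1 where "k1 = loss (sqrt N) s \<gamma> - real N * c_fun N s \<gamma>"
  show ?thesis
  proof (intro exI[of _ \<gamma>] conjI allI impI)
    show "gamma_tilde DIM((real ^ 'm) \<times> real) s < \<gamma>" using \<gamma>t by (simp add: N_def)
    fix p assume p: "1 + 2 * s / \<gamma> < p"
    have p1: "1 < p" using p \<gamma> assms divide_pos_pos[of "2 * s" \<gamma>] by linarith
    \<comment> \<open>The condition on \<open>p\<close> in the form used: the \<open>p\<close>-th
      power of the barrier decays at least as fast as the operator term of order
      \<open>- \<gamma> - 2 * s\<close>.\<close>
    have p\<gamma>: "\<gamma> + 2 * s \<le> \<gamma> * p" using p \<gamma> by (simp add: field_simps)
    define k where "k = C s * min k1 k2"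
    \<comment> \<open>The operator scales linearly in \<open>\<epsilon>\<close> and the power term
      like \<open>\<epsilon> powr p\<close>; this choice makes the latter exactly
      \<open>\<epsilon> * k\<close>.\<close>
    define \<epsilon> where "\<epsilon> = k powr (1 / (p - 1))"
    have k: "0 < k" using k1 k2 Cs by (simp add: k_def k1_def)
    have \<epsilon>: "0 < \<epsilon>" using k by (simp add: \<epsilon>_def)
    have "\<epsilon> powr p = \<epsilon> * \<epsilon> powr (p - 1)" using \<epsilon> by (simp add: powr_diff)
    also have "\<epsilon> powr (p - 1) = k" using p1 k by (simp add: \<epsilon>_def powr_powr)
    finally have \<epsilon>p: "\<epsilon> powr p = \<epsilon> * k" .
    define U where "U = (barrier \<gamma> a :: (real ^ 'm) \<times> real \<Rightarrow> real)"
    define u where "u = (\<lambda>x. \<epsilon> * U x)"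
    have \<gamma>0: "0 \<le> \<gamma>" using \<gamma> by simp
    note bounds = barrier_bounds[OF \<gamma>0, where a = a and 'm = 'm, folded U_def]
    have cU: "continuous_on UNIV U" unfolding U_def by (rule continuous_on_barrier[OF a(1)])
    then have cu: "continuous_on UNIV u" unfolding u_def by (intro continuous_intros)
    have u_bound: "\<bar>u x\<bar> \<le> \<epsilon>" for x
      using bounds(1,2)[of x] \<epsilon> by (simp add: u_def mult_left_le)
    have lsc: "lsc_on half_space u"
      unfolding lsc_on_def
    proof (intro ballI allI impI)
      fix x :: "(real ^ 'm) \<times> real" and c assume "c < u x"
      have "(u \<longlongrightarrow> u x) (at x within half_space)"
        using cu unfolding continuous_on_def by (blast intro: tendsto_within_subset)
      then show "\<forall>\<^sub>F y in at x within half_space. c < u y" using \<open>c < u x\<close> by (rule order_tendstoD)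
    qed
    have classS: "u \<in> class_S s"
      unfolding class_S_def
    proof (intro CollectI conjI ballI allI impI)
      fix x \<xi> :: "(real ^ 'm) \<times> real"
      have "continuous_on UNIV (\<lambda>\<tau>. u (x + \<tau> *\<^sub>R \<xi>))"
        by (intro continuous_on_compose2[OF cu] continuous_intros) auto
      then show "(\<lambda>\<tau>. u (x + \<tau> *\<^sub>R \<xi>)) \<in> borel_measurable lebesgue"
        by (intro measurable_completion) (simp add: borel_measurable_continuous_onI)
    next
      have "\<bar>u x\<bar> \<le> \<epsilon> * (1 + norm x) powr 0" for x
        using u_bound[of x] add_pos_nonneg[of 1 "norm x"] by simp
      then show "\<exists>\<alpha> C. 0 \<le> \<alpha> \<and> \<alpha> < 2 * s \<and> C > 0 \<and> (\<forall>x. \<bar>u x\<bar> \<le> C * (1 + norm x) powr \<alpha>)"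
        using \<epsilon> assms by (intro exI[of _ 0] exI[of _ \<epsilon>]) auto
    qed
    have touch: "op_minus C s (\<lambda>x. if x \<in> ball x0 r then \<phi> x else u x) x0 \<le> C s * (\<epsilon> * (\<Sum>\<xi>\<in>B. kernel_integral s (F \<xi>)))"
      if "0 < r" "C2_on (cball x0 r) \<phi>" "\<phi> x0 = u x0" "\<And>x. x \<in> ball x0 r \<Longrightarrow> \<phi> x \<le> u x"
        and B: "B \<in> orthonormal_bases" and F: "\<And>\<xi>. \<xi> \<in> B \<Longrightarrow> kernel_integrable s (F \<xi>)"
        "\<And>\<xi> \<tau>. \<xi> \<in> B \<Longrightarrow> 0 < \<tau> \<Longrightarrow> U (x0 + \<tau> *\<^sub>R \<xi>) + U (x0 - \<tau> *\<^sub>R \<xi>) - 2 * U x0 \<le> F \<xi> \<tau>"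
      for x0 r \<phi> B F
    proof -
      have "op_minus C s (\<lambda>x. if x \<in> ball x0 r then \<phi> x else u x) x0 \<le>
          C s * (\<Sum>\<xi>\<in>B. kernel_integral s (\<lambda>\<tau>. \<epsilon> * F \<xi> \<tau>))"
      proof (rule op_minus_test_function_le[where u = u and C = C and B = B and F = "\<lambda>\<xi> \<tau>. \<epsilon> * F \<xi> \<tau>"])
        fix \<xi> \<tau> assume "\<xi> \<in> B" "0 < (\<tau> :: real)"
        then have "\<epsilon> * (U (x0 + \<tau> *\<^sub>R \<xi>) + U (x0 - \<tau> *\<^sub>R \<xi>) - 2 * U x0) \<le> \<epsilon> * F \<xi> \<tau>"
          using F(2) \<epsilon> by (intro mult_left_mono) auto
        then show "u (x0 + \<tau> *\<^sub>R \<xi>) + u (x0 - \<tau> *\<^sub>R \<xi>) - 2 * u x0 \<le> \<epsilon> * F \<xi> \<tau>"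
          by (simp add: u_def algebra_simps)
      qed (use that assms Cs cu u_bound in \<open>auto intro: kernel_integrable_cmult\<close>)
      then show ?thesis by (simp add: kernel_integral_cmult sum_distrib_left)
    qed
    have "viscosity_supersolution s (op_minus C s) p u"
      unfolding viscosity_supersolution_def
    proof (intro conjI classS lsc ballI allI impI, elim conjE)
      fix x0 :: "(real ^ 'm) \<times> real" and r :: real and \<phi>
      assume x0: "x0 \<in> half_space" and r: "0 < r" and phi: "C2_on (cball x0 r) \<phi>" "\<phi> x0 = u x0"
        "\<forall>x\<in>ball x0 r. \<phi> x \<le> u x"
      define R where "R = norm (x0 + up)"
      have x0: "0 < snd x0" using x0 by (simp add: half_space_def)
      then have R: "1 < R" using norm_add_up_ge[of x0] by (simp add: R_def)
      have up: "u x0 powr p = \<epsilon> * k * U x0 powr p"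
        using \<epsilon> bounds(1)[of x0] by (simp add: u_def powr_mult \<epsilon>p)
      consider "U x0 = R powr (- \<gamma>)" | "U x0 = snd x0 powr a" "snd x0 powr a \<le> R powr (- \<gamma>)"
      proof -
        have "U x0 = min (R powr (- \<gamma>)) (snd x0 powr a)"
          using x0 R by (simp add: U_def barrier_def R_def)
        then show thesis using that by (cases "R powr (- \<gamma>) \<le> snd x0 powr a") (auto simp: min_def)
      qed
      then show "op_minus C s (\<lambda>x. if x \<in> ball x0 r then \<phi> x else u x) x0 + u x0 powr p \<le> 0"
      proof cases
        case 1
        obtain B F where "B \<in> orthonormal_bases" "\<And>\<xi>. \<xi> \<in> B \<Longrightarrow> kernel_integrable s (F \<xi>)"
          "\<And>\<xi> \<tau>. \<xi> \<in> B \<Longrightarrow> 0 < \<tau> \<Longrightarrow> U (x0 + \<tau> *\<^sub>R \<xi>) + U (x0 - \<tau> *\<^sub>R \<xi>) - 2 * U x0 \<le> F \<xi> \<tau>"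
          and S: "(\<Sum>\<xi>\<in>B. kernel_integral s (F \<xi>)) = R powr (- \<gamma> - 2 * s) * (- k1)"
          using barrier_interior[OF assms(1,2) \<gamma> x0, of a, folded R_def U_def] 1
          unfolding k1_def N_def by (smt (verit))
        then have "op_minus C s (\<lambda>x. if x \<in> ball x0 r then \<phi> x else u x) x0 \<le>
            C s * (\<epsilon> * (R powr (- \<gamma> - 2 * s) * (- k1)))"
          using touch[OF r phi(1,2)] phi(3) unfolding S[symmetric] by blast
        \<comment> \<open>Since \<open>R > 1\<close>, comparing the exponents
          \<open>- (\<gamma> * p)\<close> and \<open>- \<gamma> - 2 * s\<close> is enough.\<close>
        moreover have "\<epsilon> * k * U x0 powr p \<le> \<epsilon> * (C s * k1) * R powr (- \<gamma> - 2 * s)"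
        proof (intro mult_mono)
          have "U x0 powr p = R powr (- (\<gamma> * p))" using R by (simp add: 1 powr_powr)
          also have "\<dots> \<le> R powr (- \<gamma> - 2 * s)" using R p\<gamma> by (intro powr_mono) auto
          finally show "U x0 powr p \<le> R powr (- \<gamma> - 2 * s)" .
          show "k \<le> C s * k1" using Cs unfolding k_def by (intro mult_left_mono) auto
        qed (use \<epsilon> k Cs k1 in \<open>auto simp: k1_def\<close>)
        ultimately show ?thesis unfolding up by (simp add: algebra_simps)
      next
        case 2
        \<comment> \<open>The active boundary branch forces height at most \<open>1\<close>, so
          \<open>snd x0 powr (a - 2 * s) \<ge> 1\<close> dominates the power term, as the barrier is
          at most \<open>1\<close>.\<close>
        have "R powr (- \<gamma>) \<le> 1" using R \<gamma> powr_mono2'[of "- \<gamma>" 1 R] by simp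
        then have "snd x0 powr a \<le> 1" using 2 by simp
        then have h: "snd x0 \<le> 1" using powr_less_mono2[of a 1 "snd x0"] a(1) by (metis less_le_not_le linorder_not_le powr_one_eq_one zero_le_one)
        obtain F where F: "\<And>\<xi>. \<xi> \<in> Basis \<Longrightarrow> kernel_integrable s (F \<xi>)"
          "\<And>\<xi> \<tau>. \<xi> \<in> Basis \<Longrightarrow> 0 < \<tau> \<Longrightarrow> U (x0 + \<tau> *\<^sub>R \<xi>) + U (x0 - \<tau> *\<^sub>R \<xi>) - 2 * U x0 \<le> F \<xi> \<tau>"
          and S: "(\<Sum>\<xi>\<in>Basis. kernel_integral s (F \<xi>)) = snd x0 powr (a - 2 * s) * (2 powr a / (2 * s - a) - 1 / s)"
          using barrier_boundary[OF assms(1,2) \<gamma> a x0 2(1)[unfolded U_def], folded U_def] by metis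
        have "op_minus C s (\<lambda>x. if x \<in> ball x0 r then \<phi> x else u x) x0 \<le>
            C s * (\<epsilon> * (snd x0 powr (a - 2 * s) * (2 powr a / (2 * s - a) - 1 / s)))"
          using touch[OF r phi(1,2) _ Basis_orthonormal_bases F] phi(3) unfolding S by blast
        also have "\<dots> = - (\<epsilon> * (C s * k2) * snd x0 powr (a - 2 * s))"
          by (simp add: k2_def algebra_simps)
        finally have "op_minus C s (\<lambda>x. if x \<in> ball x0 r then \<phi> x else u x) x0 \<le>
            - (\<epsilon> * (C s * k2) * snd x0 powr (a - 2 * s))" .
        moreover have "\<epsilon> * k * U x0 powr p \<le> \<epsilon> * (C s * k2) * snd x0 powr (a - 2 * s)"
        proof (intro mult_mono)
          have "U x0 powr p \<le> 1 powr p" using bounds(1,2)[of x0] p1 by (intro powr_mono2) auto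
          also have "1 powr p \<le> snd x0 powr (a - 2 * s)"
            using powr_mono2'[of "a - 2 * s" "snd x0" 1] h x0 a by simp
          finally show "U x0 powr p \<le> snd x0 powr (a - 2 * s)" .
          show "k \<le> C s * k2" using Cs unfolding k_def by (intro mult_left_mono) auto
        qed (use \<epsilon> k Cs k2 in auto)
        ultimately show ?thesis unfolding up by linarith
      qed
    qed
    moreover have "\<forall>x. 0 \<le> u x" using bounds(1) \<epsilon> by (simp add: u_def)
    moreover have "bounded (range u)" unfolding bounded_iff using u_bound by auto
    moreover have "\<forall>x. x \<notin> half_space \<longrightarrow> u x = 0" using bounds(3) by (auto simp: u_def half_space_def not_less)
    moreover have "\<forall>x\<in>half_space. 0 < u x" using bounds(4) \<epsilon> by (simp add: u_def half_space_def)
    moreover have "(u \<longlongrightarrow> 0) at_infinity"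
      unfolding u_def U_def using tendsto_mult_right_zero[OF barrier_tendsto_0[OF \<gamma>]] by blast
    ultimately show "\<exists>u :: (real ^ 'm) \<times> real \<Rightarrow> real.
        viscosity_supersolution s (op_minus C s) p u \<and>
        (\<forall>x. u x \<ge> 0) \<and>
        continuous_on UNIV u \<and> bounded (range u) \<and>
        (\<forall>x. x \<notin> half_space \<longrightarrow> u x = 0) \<and>
        (\<forall>x\<in>half_space. u x > 0) \<and>
        (u \<longlongrightarrow> 0) at_infinity"
      using cu by blast
  qed
qed

end
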